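(* For every $q\in\mathbb{R}$, $q>0$, the MLB transform $B_q:L^2(\mathbb{R})\to ML_q(\mathbb{C})$ is a unitary operator whose inverse and adjoint operators are given by $$(B_q)^{-1}=(B_q)^{*}=T,$$ where $T:ML_q(\mathbb{C})\to L^2(\mathbb{R})$ is the transform defined by $$T(f)(x)=\frac{1}{q\pi}\int_{\mathbb{C}}A_q(z,x)\,f(z)\,|z|^{\frac{2}{q}-2}e^{-|z|^{2/q}}\,dA(z)$$ for every $f\in ML_q(\mathbb{C})$ and $x\in\mathbb{R}$.
   Context: $L^2(\mathbb{R})$ is the space of complex-valued square integrable functions on $\mathbb{R}$, with inner product $\langle\phi,\psi\rangle_{L^2(\mathbb{R})}=\int_{\mathbb{R}}\phi(t)\overline{\psi(t)}\,dt$. The normalized Hermite functions $\psi_n$, $n\ge 0$, are $\psi_n(x)=(2^n n!\sqrt{\pi})^{-1/2}H_n(x)e^{-x^2/2}$ with $H_n$ the (physicists') Hermite polynomials; they form an orthonormal basis of $L^2(\mathbb{R})$. For $q>0$ the Mittag-Leffler Fock space $ML_q(\mathbb{C})$ is the Hilbert space of entire functions $f$ with $\langle f,f\rangle_{ML_q(\mathbb{C})}<\infty$, where $$\langle f,g\rangle_{ML_q(\mathbb{C})}=\frac{1}{q\pi}\int_{\mathbb{C}}f(z)\overline{g(z)}\,|z|^{\frac{2}{q}-2}e^{-|z|^{2/q}}\,dA(z)$$ and $dA(z)=dx\,dy$ for $z=x+iy$. The ML-Bargmann kernel is $$A_q(z,x)=\sum_{n=0}^\infty\frac{\overline{z}^{\,n}}{\sqrt{\Gamma(qn+1)}}\psi_n(x),\qquad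 z\in\mathbb{C},\ x\in\mathbb{R}.$$ The Mittag-Leffler Bargmann (MLB) transform of $\phi\in L^2(\mathbb{R})$ is $$B_q(\phi)(z)=\int_{\mathbb{R}}\overline{A_q(z,x)}\,\phi(x)\,dx,\qquad z\in\mathbb{C}.$$
   Formalization: The integral defining T(f)(x) need not converge absolutely (e.g. q=1, f=B_1 of the indicator of [0,1]); T(f)(x) is that integral where it converges absolutely and otherwise the value of the L^2 limit of the integrals over discs |z|≤R, which is shown to exist. *)

theory Defs
  imports "HOL-Analysis.Analysis"
begin

text \<open>
  Elements of \<open>L\<^sup>2(\<real>)\<close> are represented by Borel functions; the space itself is the
  quotient of \<open>L2R\<close> by \<open>L2_eq\<close> (equality almost everywhere).
\<close>

definition L2R :: "(real \<Rightarrow> complex) set" where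
  "L2R = {\<phi> \<in> borel_measurable lborel. integrable lborel (\<lambda>x. (cmod (\<phi> x))\<^sup>2)}"

definition L2_eq :: "(real \<Rightarrow> complex) \<Rightarrow> (real \<Rightarrow> complex) \<Rightarrow> bool" where
  "L2_eq \<phi> \<psi> \<longleftrightarrow> (AE x in lborel. \<phi> x = \<psi> x)"

definition L2_inner :: "(real \<Rightarrow> complex) \<Rightarrow> (real \<Rightarrow> complex) \<Rightarrow> complex" where
  "L2_inner \<phi> \<psi> = (LINT t|lborel. \<phi> t * cnj (\<psi> t))"

definition L2_tendsto :: "(real \<Rightarrow> real \<Rightarrow> complex) \<Rightarrow> (real \<Rightarrow> complex) \<Rightarrow> bool" where
  "L2_tendsto F g \<longleftrightarrow> (\<forall>R. F R \<in> L2R) \<and> g \<in> L2R \<and>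
     ((\<lambda>R. LINT x|lborel. (cmod (F R x - g x))\<^sup>2) \<longlongrightarrow> 0) at_top"

definition L2_lim :: "(real \<Rightarrow> real \<Rightarrow> complex) \<Rightarrow> real \<Rightarrow> complex" where
  "L2_lim F = (SOME g. L2_tendsto F g)"

fun hermite :: "nat \<Rightarrow> real \<Rightarrow> real" where
  "hermite 0 x = 1"
| "hermite (Suc 0) x = 2 * x"
| "hermite (Suc (Suc n)) x = 2 * x * hermite (Suc n) x - 2 * real (Suc n) * hermite n x"

definition hermite_fun :: "nat \<Rightarrow> real \<Rightarrow> real" where
  "hermite_fun n x = hermite n x * exp (- x\<^sup>2 / 2) / sqrt (2 ^ n * fact n * sqrt pi)"

definition MLF_weight :: "real \<Rightarrow> complex \<Rightarrow> real" where
  "MLF_weight q z = cmod z powr (2 / q - 2) * exp (- (cmod z powr (2 / q)))"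

definition MLF_space :: "real \<Rightarrow> (complex \<Rightarrow> complex) set" where
  "MLF_space q = {f. f holomorphic_on UNIV \<and>
     integrable lborel (\<lambda>z. (cmod (f z))\<^sup>2 * MLF_weight q z)}"

definition MLF_inner :: "real \<Rightarrow> (complex \<Rightarrow> complex) \<Rightarrow> (complex \<Rightarrow> complex) \<Rightarrow> complex" where
  "MLF_inner q f g =
     of_real (1 / (q * pi)) * (LINT z|lborel. f z * cnj (g z) * of_real (MLF_weight q z))"

definition MLB_kernel :: "real \<Rightarrow> complex \<Rightarrow> real \<Rightarrow> complex" where
  "MLB_kernel q z x =
     (\<Sum>n. cnj z ^ n / of_real (sqrt (Gamma (q * real n + 1))) * of_real (hermite_fun n x))"

definition MLB :: "real \<Rightarrow> (real \<Rightarrow> complex) \<Rightarrow> complex \<Rightarrow> complex" where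
  "MLB q \<phi> z = (LINT x|lborel. cnj (MLB_kernel q z x) * \<phi> x)"

definition MLT_integrand :: "real \<Rightarrow> (complex \<Rightarrow> complex) \<Rightarrow> real \<Rightarrow> complex \<Rightarrow> complex" where
  "MLT_integrand q f x z = MLB_kernel q z x * f z * of_real (MLF_weight q z)"

definition MLT_trunc ::
    "real \<Rightarrow> (complex \<Rightarrow> complex) \<Rightarrow> real \<Rightarrow> real \<Rightarrow> complex" where
  "MLT_trunc q f R x =
     of_real (1 / (q * pi)) * (LINT z:cball 0 R|lborel. MLT_integrand q f x z)"

text \<open>
  The function \<open>z \<mapsto> MLB_kernel q z x\<close> is not square integrable against the weight, and for
  general \<open>f \<in> MLF_space q\<close> the integral over the plane that defines \<open>T(f)(x)\<close> need not converge
  absolutely (for \<open>q = 1\<close> it is the classical inverse Bargmann integral). It is taken literally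
  at every \<open>x\<close> where it converges absolutely, and elsewhere as the \<open>L\<^sup>2(\<real>)\<close> limit
  of the integrals over the discs \<open>cball 0 R\<close> as \<open>R\<close> tends to infinity.
\<close>

definition MLT :: "real \<Rightarrow> (complex \<Rightarrow> complex) \<Rightarrow> real \<Rightarrow> complex" where
  "MLT q f x =
     (if integrable lborel (MLT_integrand q f x)
      then of_real (1 / (q * pi)) * (LINT z|lborel. MLT_integrand q f x z)
      else L2_lim (MLT_trunc q f) x)"

text \<open>
  For operators between \<open>L\<^sup>2(\<real>)\<close> and \<open>MLF_space q\<close>: the second clause below says that
  \<open>U\<close> is well defined and injective on almost-everywhere classes.
\<close>

definition unitary_L2_ML :: "real \<Rightarrow> ((real \<Rightarrow> complex) \<Rightarrow> complex \<Rightarrow> complex) \<Rightarrow> bool" where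
  "unitary_L2_ML q U \<longleftrightarrow>
     (\<forall>\<phi>\<in>L2R. U \<phi> \<in> MLF_space q) \<and>
     (\<forall>\<phi>\<in>L2R. \<forall>\<psi>\<in>L2R. U \<phi> = U \<psi> \<longleftrightarrow> L2_eq \<phi> \<psi>) \<and>
     (\<forall>\<phi>\<in>L2R. \<forall>\<psi>\<in>L2R. \<forall>a b.
        U (\<lambda>x. a * \<phi> x + b * \<psi> x) = (\<lambda>z. a * U \<phi> z + b * U \<psi> z)) \<and>
     (\<forall>\<phi>\<in>L2R. \<forall>\<psi>\<in>L2R. MLF_inner q (U \<phi>) (U \<psi>) = L2_inner \<phi> \<psi>) \<and>
     (\<forall>f\<in>MLF_space q. \<exists>\<phi>\<in>L2R. U \<phi> = f)"

definition inverse_L2_ML :: "real \<Rightarrow> ((real \<Rightarrow> complex) \<Rightarrow> complex \<Rightarrow> complex) \<Rightarrow>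
    ((complex \<Rightarrow> complex) \<Rightarrow> real \<Rightarrow> complex) \<Rightarrow> bool" where
  "inverse_L2_ML q U V \<longleftrightarrow>
     (\<forall>f\<in>MLF_space q. V f \<in> L2R \<and> U (V f) = f) \<and>
     (\<forall>\<phi>\<in>L2R. U \<phi> \<in> MLF_space q \<and> L2_eq (V (U \<phi>)) \<phi>)"

definition adjoint_L2_ML :: "real \<Rightarrow> ((real \<Rightarrow> complex) \<Rightarrow> complex \<Rightarrow> complex) \<Rightarrow>
    ((complex \<Rightarrow> complex) \<Rightarrow> real \<Rightarrow> complex) \<Rightarrow> bool" where
  "adjoint_L2_ML q U V \<longleftrightarrow>
     (\<forall>f\<in>MLF_space q. V f \<in> L2R) \<and>
     (\<forall>\<phi>\<in>L2R. \<forall>f\<in>MLF_space q. MLF_inner q (U \<phi>) f = L2_inner \<phi> (V f))"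

end

theory Submission
  imports Defs "HOL-Probability.Levy" "HOL-Real_Asymp.Real_Asymp"
    "HOL-Complex_Analysis.Cauchy_Integral_Formula"
begin

text \<open>
  The normalized monomials \<open>e\<^sub>n(z) = z\<^sup>n / sqrt (\<Gamma>(q n + 1))\<close> are orthonormal in \<open>ML\<^sub>q\<close>: rotation
  invariance makes different monomials orthogonal on every disc, and the substitution
  \<open>t = |z|\<^bsup>2/q\<^esup>\<close> turns the weighted planar measure into \<open>e\<^bsup>-t\<^esup> dt\<close>, so that the moments are
  Gamma values. Since the Taylor series of an entire function may be integrated termwise over
  discs, its Taylor coefficients are its coefficients in the system \<open>e\<^sub>n\<close>. The Hermite functions
  \<open>\<psi>\<^sub>n\<close> form a complete orthonormal system in \<open>L\<^sup>2(\<real>)\<close>, and termwise integration of the kernel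
  shows that \<open>B\<^sub>q\<close> sends \<open>\<Sum> a\<^sub>n \<psi>\<^sub>n\<close> to \<open>\<Sum> a\<^sub>n e\<^sub>n\<close>. Integrating over the disc of radius \<open>R\<close>
  sends \<open>\<Sum> a\<^sub>n e\<^sub>n\<close> to \<open>\<Sum> a\<^sub>n c\<^sub>n(R) \<psi>\<^sub>n\<close> with \<open>0 \<le> c\<^sub>n(R) \<le> 1\<close> and \<open>c\<^sub>n(R) \<longlonglongrightarrow> 1\<close>, which
  converges in \<open>L\<^sup>2\<close> to \<open>\<Sum> a\<^sub>n \<psi>\<^sub>n\<close>.
\<close>

section \<open>Orthonormal sequences in \<open>L\<^sup>2\<close>\<close>

text \<open>The weighted measure has total mass one, so every \<open>f\<close> in the space is
  integrable, yet against the kernel it may fail to be. Discs repair this from two sides: on a disc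
  the kernel series times \<open>f\<close> is dominated by a summable sequence times
  \<open>cmod (f z)\<close>, and rotation invariance makes truncation diagonal, with factors
  independent of \<open>f\<close>. Completeness of the monomials comes from analyticity: the Taylor
  series converges everywhere, Bessel makes its coefficients square summable, and Fatou turns the
  two into convergence in norm. The remaining obstacle is that \<open>MLT\<close> mixes two notions
  of value, an integral where it converges absolutely and a chosen limit in the mean elsewhere. On
  the first set the truncations also converge pointwise, and a pointwise limit agrees almost
  everywhere with a limit in the mean, so both branches represent one class. Surjectivity and the
  adjoint formula then cost nothing: \<open>MLB q (MLT q f) = f\<close> exhibits a preimage, and the
  isometry applied to \<open>MLT q f\<close> is the adjoint identity.\<close>

definition sqint :: "'a measure \<Rightarrow> ('a \<Rightarrow> complex) set" where
  "sqint M = {f \<in> borel_measurable M. integrable M (\<lambda>x. (cmod (f x))\<^sup>2)}"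

definition ip :: "'a measure \<Rightarrow> ('a \<Rightarrow> complex) \<Rightarrow> ('a \<Rightarrow> complex) \<Rightarrow> complex" where
  "ip M f g = (LINT x|M. f x * cnj (g x))"

definition nsq :: "'a measure \<Rightarrow> ('a \<Rightarrow> complex) \<Rightarrow> real" where
  "nsq M f = (LINT x|M. (cmod (f x))\<^sup>2)"

lemma sqint_measurable [measurable_dest]: "f \<in> sqint M \<Longrightarrow> f \<in> borel_measurable M"
  by (simp add: sqint_def)

lemma sqint_integrable: "f \<in> sqint M \<Longrightarrow> integrable M (\<lambda>x. (cmod (f x))\<^sup>2)"
  by (simp add: sqint_def)

lemma tendsto_zero_le:
  fixes f g :: "nat \<Rightarrow> real"
  assumes "\<And>n. 0 \<le> f n" "\<And>n. f n \<le> g n" "g \<longlonglongrightarrow> 0"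
  shows "f \<longlonglongrightarrow> 0"
  by (rule tendsto_sandwich[OF _ _ tendsto_const assms(3)]) (simp_all add: assms)

lemma two_mult_le_squares: "2 * (a * b) \<le> a\<^sup>2 + (b::real)\<^sup>2"
  using sum_squares_bound[of a b] by simp

lemma sqint_mult_norm_integrable:
  assumes "f \<in> sqint M" "g \<in> sqint M"
  shows "integrable M (\<lambda>x. cmod (f x) * cmod (g x))"
proof (rule Bochner_Integration.integrable_bound)
  show "integrable M (\<lambda>x. (cmod (f x))\<^sup>2 + (cmod (g x))\<^sup>2)"
    using assms by (auto intro: sqint_integrable)
  have "cmod (f x) * cmod (g x) \<le> (cmod (f x))\<^sup>2 + (cmod (g x))\<^sup>2" for x
  proof -
    have "0 \<le> cmod (f x) * cmod (g x)" by simp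
    then show ?thesis using two_mult_le_squares[of "cmod (f x)" "cmod (g x)"] by linarith
  qed
  then show "AE x in M. norm (cmod (f x) * cmod (g x)) \<le> norm ((cmod (f x))\<^sup>2 + (cmod (g x))\<^sup>2)"
    by (simp add: abs_mult)
qed (use assms in measurable)

lemma borel_measurable_cnj [measurable (raw)]:
  "f \<in> borel_measurable M \<Longrightarrow> (\<lambda>x. cnj (f x)) \<in> borel_measurable M"
  by (rule measurable_compose[OF _ borel_measurable_continuous_onI[OF continuous_on_cnj[OF continuous_on_id]]])

lemma sqint_mult_integrable:
  assumes "f \<in> sqint M" "g \<in> sqint M"
  shows "integrable M (\<lambda>x. f x * cnj (g x))"
proof (rule Bochner_Integration.integrable_bound[OF sqint_mult_norm_integrable[OF assms]])
  show "AE x in M. norm (f x * cnj (g x)) \<le> norm (cmod (f x) * cmod (g x))"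
    by (simp add: norm_mult abs_mult)
  show "(\<lambda>x. f x * cnj (g x)) \<in> borel_measurable M"
    using assms by measurable
qed

lemma sqint_zero: "(\<lambda>x. 0) \<in> sqint M"
  by (simp add: sqint_def)

lemma sqint_add:
  assumes "f \<in> sqint M" "g \<in> sqint M"
  shows "(\<lambda>x. f x + g x) \<in> sqint M"
proof -
  have "integrable M (\<lambda>x. (cmod (f x + g x))\<^sup>2)"
  proof (rule Bochner_Integration.integrable_bound)
    show "integrable M (\<lambda>x. 2 * (cmod (f x))\<^sup>2 + 2 * (cmod (g x))\<^sup>2)"
      by (intro Bochner_Integration.integrable_add integrable_mult_right impI sqint_integrable assms)
    have "(cmod (f x + g x))\<^sup>2 \<le> 2 * (cmod (f x))\<^sup>2 + 2 * (cmod (g x))\<^sup>2" for x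
    proof -
      have "(cmod (f x + g x))\<^sup>2 \<le> (cmod (f x) + cmod (g x))\<^sup>2"
        by (intro power_mono norm_triangle_ineq) auto
      then show ?thesis
        using two_mult_le_squares[of "cmod (f x)" "cmod (g x)"]
        by (simp add: power2_sum)
    qed
    then show "AE x in M. norm ((cmod (f x + g x))\<^sup>2)
        \<le> norm (2 * (cmod (f x))\<^sup>2 + 2 * (cmod (g x))\<^sup>2)" by simp
  qed (use assms in measurable)
  then show ?thesis using assms by (simp add: sqint_def borel_measurable_add)
qed

lemma sqint_cmult: "f \<in> sqint M \<Longrightarrow> (\<lambda>x. c * f x) \<in> sqint M"
  by (auto simp: sqint_def norm_mult power_mult_distrib)

lemma sqint_diff: "f \<in> sqint M \<Longrightarrow> g \<in> sqint M \<Longrightarrow> (\<lambda>x. f x - g x) \<in> sqint M"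
  using sqint_add[of f M "\<lambda>x. (-1) * g x"] sqint_cmult[of g M "-1"] by simp

lemma sqint_sum: "(\<And>i. i \<in> I \<Longrightarrow> f i \<in> sqint M) \<Longrightarrow> (\<lambda>x. \<Sum>i\<in>I. f i x) \<in> sqint M"
  by (induction I rule: infinite_finite_induct) (auto intro: sqint_zero sqint_add)

lemma ip_add_left: "\<lbrakk>f \<in> sqint M; g \<in> sqint M; h \<in> sqint M\<rbrakk> \<Longrightarrow>
    ip M (\<lambda>x. f x + g x) h = ip M f h + ip M g h"
  unfolding ip_def by (simp add: distrib_right sqint_mult_integrable)

lemma ip_diff_left: "\<lbrakk>f \<in> sqint M; g \<in> sqint M; h \<in> sqint M\<rbrakk> \<Longrightarrow>
    ip M (\<lambda>x. f x - g x) h = ip M f h - ip M g h"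
  unfolding ip_def by (simp add: left_diff_distrib sqint_mult_integrable)

lemma ip_cmult_left: "ip M (\<lambda>x. c * f x) h = c * ip M f h"
  unfolding ip_def by (simp add: mult.assoc)

lemma ip_cnj: "cnj (ip M f g) = ip M g f"
  unfolding ip_def by (simp flip: Bochner_Integration.integral_cnj add: mult.commute)

lemma ip_sum_left: "\<lbrakk>\<And>i. i \<in> I \<Longrightarrow> f i \<in> sqint M; h \<in> sqint M\<rbrakk> \<Longrightarrow>
    ip M (\<lambda>x. \<Sum>i\<in>I. f i x) h = (\<Sum>i\<in>I. ip M (f i) h)"
  unfolding ip_def by (simp add: sum_distrib_right sqint_mult_integrable)

lemma ip_self: "ip M f f = complex_of_real (nsq M f)"
  unfolding ip_def nsq_def integral_complex_of_real[symmetric]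
  by (simp only: complex_norm_square)

lemma nsq_nonneg: "0 \<le> nsq M f"
  by (simp add: nsq_def)

lemma ip_Cauchy_Schwarz:
  assumes "f \<in> sqint M" "g \<in> sqint M"
  shows "(cmod (ip M f g))\<^sup>2 \<le> nsq M f * nsq M g"
proof -
  have [measurable]: "f \<in> borel_measurable M" "g \<in> borel_measurable M"
    using assms by (auto simp: sqint_def)
  let ?I = "LINT x|M. cmod (f x) * cmod (g x)"
  have "cmod (ip M f g) \<le> ?I"
    unfolding ip_def by (rule integral_norm_bound[THEN order_trans]) (simp add: norm_mult)
  moreover have "(\<integral>\<^sup>+x. ennreal (cmod (f x)) * ennreal (cmod (g x)) \<partial>M)\<^sup>2 \<le>
      (\<integral>\<^sup>+x. (ennreal (cmod (f x)))\<^sup>2 \<partial>M) * (\<integral>\<^sup>+x. (ennreal (cmod (g x)))\<^sup>2 \<partial>M)"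
    by (rule Cauchy_Schwarz_nn_integral) auto
  then have "(ennreal ?I)\<^sup>2 \<le> ennreal (nsq M f) * ennreal (nsq M g)"
    unfolding nsq_def
    using assms by (simp add: nn_integral_eq_integral[symmetric] sqint_mult_norm_integrable
        sqint_integrable ennreal_mult' ennreal_power)
  then have "?I\<^sup>2 \<le> nsq M f * nsq M g"
    by (simp add: ennreal_power ennreal_mult[symmetric] nsq_nonneg)
  ultimately show ?thesis
    by (meson norm_ge_zero order_trans power_mono)
qed

lemma nsq_eq_0_AE:
  assumes "f \<in> sqint M" "nsq M f = 0" shows "AE x in M. f x = 0"
  using assms integral_nonneg_eq_0_iff_AE[of M "\<lambda>x. (cmod (f x))\<^sup>2"]
  by (auto simp: nsq_def sqint_def)

lemma nn_nsq: "f \<in> sqint M \<Longrightarrow> (\<integral>\<^sup>+x. ennreal ((cmod (f x))\<^sup>2) \<partial>M) = ennreal (nsq M f)"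
  unfolding nsq_def by (intro nn_integral_eq_integral) (auto intro: sqint_integrable)

text \<open>Fatou's lemma only bounds nonnegative integrals; this lemma and the next carry such
  bounds back to \<open>sqint\<close> and \<open>nsq\<close>.\<close>

lemma sqint_nn_boundI:
  assumes [measurable]: "f \<in> borel_measurable M"
    and "(\<integral>\<^sup>+x. ennreal ((cmod (f x))\<^sup>2) \<partial>M) \<le> ennreal B"
  shows "f \<in> sqint M"
  using assms by (auto simp: sqint_def integrable_iff_bounded le_less_trans)

lemma nsq_le_nn:
  assumes "f \<in> sqint M" "(\<integral>\<^sup>+x. ennreal ((cmod (f x))\<^sup>2) \<partial>M) \<le> ennreal B" "0 \<le> B"
  shows "nsq M f \<le> B"
  using assms nn_nsq[OF assms(1)] by simp

section \<open>Bessel, Parseval and Riesz-Fischer for an abstract orthonormal sequence\<close>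

locale orthonormal_seq =
  fixes M :: "'a measure" and e :: "nat \<Rightarrow> 'a \<Rightarrow> complex"
  assumes e_sqint [simp]: "e n \<in> sqint M"
    and e_orth: "ip M (e m) (e n) = (if m = n then 1 else 0)"
begin

definition psum :: "(nat \<Rightarrow> complex) \<Rightarrow> nat \<Rightarrow> 'a \<Rightarrow> complex" where
  "psum a N x = (\<Sum>n<N. a n * e n x)"

text \<open>The coefficients are a parameter instead of being computed from \<open>u\<close>,
  because sequences found in one Hilbert space are fed into the other. That they are the inner
  products is a consequence, \<open>expands_coeff\<close>.\<close>

definition expands :: "('a \<Rightarrow> complex) \<Rightarrow> (nat \<Rightarrow> complex) \<Rightarrow> bool" where
  "expands u a \<longleftrightarrow> u \<in> sqint M \<and> (\<lambda>N. nsq M (\<lambda>x. u x - psum a N x)) \<longlonglongrightarrow> 0"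

lemma lincomb_sqint: "(\<lambda>x. \<Sum>n\<in>I. a n * e n x) \<in> sqint M"
  by (intro sqint_sum sqint_cmult e_sqint)

lemma psum_sqint [simp]: "psum a N \<in> sqint M"
  unfolding psum_def[abs_def] by (rule lincomb_sqint)

lemma ip_lincomb: "u \<in> sqint M \<Longrightarrow> ip M (\<lambda>x. \<Sum>n\<in>I. a n * e n x) u = (\<Sum>n\<in>I. a n * ip M (e n) u)"
  by (simp add: ip_sum_left sqint_cmult ip_cmult_left)

lemma ip_lincomb_e: "finite I \<Longrightarrow>
    ip M (\<lambda>x. \<Sum>n\<in>I. a n * e n x) (e k) = (if k \<in> I then a k else 0)"
  by (auto simp: ip_lincomb e_orth if_distrib cong: if_cong)

lemma nsq_lincomb: "finite I \<Longrightarrow> nsq M (\<lambda>x. \<Sum>n\<in>I. a n * e n x) = (\<Sum>n\<in>I. (cmod (a n))\<^sup>2)"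
proof -
  assume I: "finite I"
  let ?u = "\<lambda>x. \<Sum>n\<in>I. a n * e n x"
  have "complex_of_real (nsq M ?u) = (\<Sum>n\<in>I. a n * cnj (ip M ?u (e n)))"
    by (simp only: ip_self[symmetric] ip_lincomb[OF lincomb_sqint] ip_cnj)
  also have "\<dots> = (\<Sum>n\<in>I. a n * cnj (a n))"
    by (intro sum.cong) (auto simp: ip_lincomb_e I)
  also have "\<dots> = complex_of_real (\<Sum>n\<in>I. (cmod (a n))\<^sup>2)"
    by (simp only: of_real_sum complex_norm_square)
  finally show ?thesis by (simp only: of_real_eq_iff)
qed

lemma psum_diff: "N \<le> K \<Longrightarrow> psum a K x - psum a N x = (\<Sum>n\<in>{N..<K}. a n * e n x)"
  unfolding psum_def lessThan_atLeast0 by (rule sum_diff_nat_ivl) auto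

lemma nsq_psum_diff: "N \<le> K \<Longrightarrow>
    nsq M (\<lambda>x. psum a K x - psum a N x) = (\<Sum>n\<in>{N..<K}. (cmod (a n))\<^sup>2)"
  by (simp add: psum_diff nsq_lincomb)

text \<open>Expanding the square, both cross terms and the square of the partial sum equal
  \<open>?S\<close> up to sign, so one copy survives. Nonnegativity of the left side is Bessel's
  inequality.\<close>

lemma nsq_residual:
  assumes u: "u \<in> sqint M"
  shows "nsq M (\<lambda>x. u x - psum (\<lambda>n. ip M u (e n)) N x) =
    nsq M u - (\<Sum>n<N. (cmod (ip M u (e n)))\<^sup>2)"
proof -
  let ?s = "psum (\<lambda>n. ip M u (e n)) N" and ?S = "\<Sum>n<N. (cmod (ip M u (e n)))\<^sup>2"
  have s: "?s \<in> sqint M" by simp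
  have c: "ip M (e n) u = cnj (ip M u (e n))" for n
    by (simp only: ip_cnj)
  have su: "ip M ?s u = complex_of_real ?S"
    unfolding psum_def[abs_def]
    by (simp only: ip_lincomb[OF u] c of_real_sum complex_norm_square)
  have ss: "nsq M ?s = ?S"
    unfolding psum_def[abs_def] by (simp add: nsq_lincomb)
  have d: "(\<lambda>x. u x - ?s x) \<in> sqint M" by (intro sqint_diff u s)
  have "complex_of_real (nsq M (\<lambda>x. u x - ?s x)) = ip M (\<lambda>x. u x - ?s x) (\<lambda>x. u x - ?s x)"
    by (simp add: ip_self)
  also have "\<dots> = ip M u (\<lambda>x. u x - ?s x) - ip M ?s (\<lambda>x. u x - ?s x)"
    by (rule ip_diff_left[OF u s d])
  also have "\<dots> = cnj (ip M (\<lambda>x. u x - ?s x) u) - cnj (ip M (\<lambda>x. u x - ?s x) ?s)"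
    by (simp add: ip_cnj)
  also have "\<dots> = cnj (ip M u u - ip M ?s u) - cnj (ip M u ?s - ip M ?s ?s)"
    by (simp add: ip_diff_left u s)
  also have "\<dots> = complex_of_real (nsq M u - ?S)"
    using su ip_cnj[of M ?s u] by (simp add: ip_self ss flip: ip_cnj[of M ?s u])
  finally show ?thesis by (simp only: of_real_eq_iff)
qed

lemma Bessel:
  assumes u: "u \<in> sqint M"
  shows "summable (\<lambda>n. (cmod (ip M u (e n)))\<^sup>2)"
proof (rule summableI_nonneg_bounded)
  show "(\<Sum>n<N. (cmod (ip M u (e n)))\<^sup>2) \<le> nsq M u" for N
    using nsq_residual[OF u, of N] nsq_nonneg[of M "\<lambda>x. u x - psum (\<lambda>n. ip M u (e n)) N x"]
    by simp
qed simp

text \<open>Continuity of the inner product in its first argument: Cauchy-Schwarz applied to the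
  remainder of the expansion.\<close>

lemma expands_ip:
  assumes E: "expands u a" and v: "v \<in> sqint M"
  shows "(\<lambda>n. a n * ip M (e n) v) sums ip M u v"
proof -
  have u: "u \<in> sqint M" using E by (simp add: expands_def)
  have "(\<lambda>N. nsq M (\<lambda>x. u x - psum a N x) * nsq M v) \<longlonglongrightarrow> 0 * nsq M v"
    using E by (intro tendsto_intros) (simp add: expands_def)
  then have "(\<lambda>N. (cmod (ip M (\<lambda>x. u x - psum a N x) v))\<^sup>2) \<longlonglongrightarrow> 0"
    by (intro tendsto_zero_le[OF _ ip_Cauchy_Schwarz]) (simp_all add: sqint_diff u v)
  then have "(\<lambda>N. sqrt ((cmod (ip M (\<lambda>x. u x - psum a N x) v))\<^sup>2)) \<longlonglongrightarrow> sqrt 0"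
    by (rule tendsto_real_sqrt)
  then have "(\<lambda>N. ip M (\<lambda>x. u x - psum a N x) v) \<longlonglongrightarrow> 0"
    by (simp add: tendsto_norm_zero_iff)
  moreover have "ip M (\<lambda>x. u x - psum a N x) v = ip M u v - (\<Sum>n<N. a n * ip M (e n) v)" for N
    unfolding ip_diff_left[OF u psum_sqint v] by (simp add: psum_def[abs_def] ip_lincomb v)
  ultimately have "(\<lambda>N. ip M u v - (ip M u v - (\<Sum>n<N. a n * ip M (e n) v))) \<longlonglongrightarrow> ip M u v - 0"
    by (intro tendsto_intros) simp
  then show ?thesis by (simp add: sums_def)
qed

lemma expands_coeff: "expands u a \<Longrightarrow> ip M u (e k) = a k"
proof -
  assume "expands u a"
  then have "(\<lambda>n. a n * ip M (e n) (e k)) sums ip M u (e k)"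
    by (rule expands_ip) simp
  moreover have "(\<lambda>n. a n * ip M (e n) (e k)) = (\<lambda>n. if n = k then a n else 0)"
    by (auto simp: e_orth)
  ultimately show ?thesis using sums_single[of k a] sums_unique2 by metis
qed

lemma Parseval:
  assumes "expands u a" "expands v b"
  shows "(\<lambda>n. a n * cnj (b n)) sums ip M u v"
proof -
  have "ip M (e n) v = cnj (b n)" for n
    using expands_coeff[OF assms(2), of n] ip_cnj by metis
  then show ?thesis using expands_ip[OF assms(1), of v] assms(2)
    by (simp add: expands_def)
qed

lemma expands_nsq:
  assumes "expands u a" shows "(\<lambda>n. (cmod (a n))\<^sup>2) sums nsq M u"
proof -
  have "(\<lambda>n. complex_of_real ((cmod (a n))\<^sup>2)) sums complex_of_real (nsq M u)"
    using Parseval[OF assms assms] by (simp only: ip_self complex_norm_square)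
  then show ?thesis by (simp only: sums_of_real_iff)
qed

lemma expands_summable: "expands u a \<Longrightarrow> summable (\<lambda>n. (cmod (a n))\<^sup>2)"
  using expands_nsq by (auto simp: sums_iff)

text \<open>Together with \<open>expands_nsq\<close> this turns the distance between two expanded
  functions into a series over coefficient differences.\<close>

lemma expands_diff:
  assumes "expands u a" "expands v b" shows "expands (\<lambda>x. u x - v x) (\<lambda>n. a n - b n)"
proof -
  have uv: "u \<in> sqint M" "v \<in> sqint M" using assms by (auto simp: expands_def)
  have "nsq M (\<lambda>x. (u x - v x) - psum (\<lambda>n. a n - b n) N x) \<le>
      2 * nsq M (\<lambda>x. u x - psum a N x) + 2 * nsq M (\<lambda>x. v x - psum b N x)" for N
  proof -
    have p: "psum (\<lambda>n. a n - b n) N x = psum a N x - psum b N x" for x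
      by (simp add: psum_def left_diff_distrib sum_subtractf)
    have "(cmod ((u x - v x) - psum (\<lambda>n. a n - b n) N x))\<^sup>2 \<le>
        2 * (cmod (u x - psum a N x))\<^sup>2 + 2 * (cmod (v x - psum b N x))\<^sup>2" for x
    proof -
      have "cmod ((u x - psum a N x) - (v x - psum b N x)) \<le>
          cmod (u x - psum a N x) + cmod (v x - psum b N x)"
        by (rule norm_triangle_ineq4)
      then have "(cmod ((u x - v x) - psum (\<lambda>n. a n - b n) N x))\<^sup>2 \<le>
          (cmod (u x - psum a N x) + cmod (v x - psum b N x))\<^sup>2"
        by (intro power_mono) (auto simp: p algebra_simps)
      then show ?thesis
        using two_mult_le_squares[of "cmod (u x - psum a N x)" "cmod (v x - psum b N x)"]
        by (simp add: power2_sum)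
    qed
    then have "nsq M (\<lambda>x. (u x - v x) - psum (\<lambda>n. a n - b n) N x) \<le>
        (LINT x|M. 2 * (cmod (u x - psum a N x))\<^sup>2 + 2 * (cmod (v x - psum b N x))\<^sup>2)"
      unfolding nsq_def
      by (intro integral_mono Bochner_Integration.integrable_add integrable_mult_right impI
          sqint_integrable sqint_diff uv psum_sqint) auto
    also have "\<dots> = 2 * nsq M (\<lambda>x. u x - psum a N x) + 2 * nsq M (\<lambda>x. v x - psum b N x)"
      unfolding nsq_def
      by (simp add: sqint_integrable sqint_diff uv)
    finally show ?thesis .
  qed
  moreover have "(\<lambda>N. 2 * nsq M (\<lambda>x. u x - psum a N x) + 2 * nsq M (\<lambda>x. v x - psum b N x)) \<longlonglongrightarrow> 2 * 0 + 2 * 0"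
    using assms by (intro tendsto_intros) (auto simp: expands_def)
  ultimately have "(\<lambda>N. nsq M (\<lambda>x. (u x - v x) - psum (\<lambda>n. a n - b n) N x)) \<longlonglongrightarrow> 0"
    by (intro tendsto_zero_le[OF nsq_nonneg]) simp_all
  then show ?thesis by (simp add: expands_def sqint_diff uv)
qed

text \<open>Both pointwise convergent series and the subsequences that occur in the
  Riesz--Fischer theorem are covered by allowing an index sequence \<open>r\<close>.\<close>

lemma expands_pointwise:
  assumes sm: "summable (\<lambda>n. (cmod (a n))\<^sup>2)"
    and [measurable]: "u \<in> borel_measurable M"
    and r: "filterlim r at_top sequentially"
    and lim: "AE x in M. (\<lambda>k. psum a (r k) x) \<longlonglongrightarrow> u x"
  shows "expands u a"
proof -
  define t where "t N = (\<Sum>n. (cmod (a (n + N)))\<^sup>2)" for N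
  have t_nonneg: "0 \<le> t N" for N
    unfolding t_def using sm by (intro suminf_nonneg summable_ignore_initial_segment) auto
  have t_le: "(\<Sum>n\<in>{N..<K}. (cmod (a n))\<^sup>2) \<le> t N" for N K
  proof -
    have "(\<Sum>n\<in>{N..<K}. (cmod (a n))\<^sup>2) \<le> (\<Sum>n\<in>{0+N..<K+N}. (cmod (a n))\<^sup>2)"
      by (intro sum_mono2) auto
    also have "\<dots> = (\<Sum>n\<in>{0..<K}. (cmod (a (n + N)))\<^sup>2)"
      by (rule sum.shift_bounds_nat_ivl)
    also have "\<dots> \<le> t N"
      unfolding t_def using sm by (intro sum_le_suminf summable_ignore_initial_segment) auto
    finally show ?thesis .
  qed
  have pm [measurable]: "psum a N \<in> borel_measurable M" for N
    using psum_sqint by (rule sqint_measurable)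
  \<comment> \<open>Fatou along the indices \<open>r k\<close>: once \<open>r k \<ge> N\<close>, the
    squared norm of \<open>psum a (r k) - psum a N\<close> is a finite block of the coefficient
    series, hence at most the tail \<open>t N\<close>, and the bound survives in the limit.\<close>
  have bound: "(\<integral>\<^sup>+x. ennreal ((cmod (u x - psum a N x))\<^sup>2) \<partial>M) \<le> ennreal (t N)" for N
  proof -
    have "(\<integral>\<^sup>+x. ennreal ((cmod (u x - psum a N x))\<^sup>2) \<partial>M) =
        (\<integral>\<^sup>+x. liminf (\<lambda>k. ennreal ((cmod (psum a (r k) x - psum a N x))\<^sup>2)) \<partial>M)"
    proof (rule nn_integral_cong_AE, use lim in eventually_elim)
      case (elim x)
      then have "(\<lambda>k. ennreal ((cmod (psum a (r k) x - psum a N x))\<^sup>2)) \<longlonglongrightarrow>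
          ennreal ((cmod (u x - psum a N x))\<^sup>2)"
        by (intro tendsto_intros tendsto_ennrealI)
      then show ?case by (metis lim_imp_Liminf sequentially_bot)
    qed
    also have "\<dots> \<le> liminf (\<lambda>k. \<integral>\<^sup>+x. ennreal ((cmod (psum a (r k) x - psum a N x))\<^sup>2) \<partial>M)"
      by (rule nn_integral_liminf) auto
    also have "\<dots> \<le> liminf (\<lambda>k. ennreal (t N))"
    proof (rule Liminf_mono)
      have "eventually (\<lambda>k. r k \<ge> N) sequentially"
        using r by (simp add: filterlim_at_top)
      then show "eventually (\<lambda>k. (\<integral>\<^sup>+x. ennreal ((cmod (psum a (r k) x - psum a N x))\<^sup>2) \<partial>M)
          \<le> ennreal (t N)) sequentially"
      proof eventually_elim
        case (elim k)
        then show ?case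
          by (subst nn_nsq) (auto intro!: sqint_diff ennreal_leI t_le simp: nsq_psum_diff)
      qed
    qed
    also have "\<dots> = ennreal (t N)" by (simp add: Liminf_const)
    finally show ?thesis .
  qed
  have d: "(\<lambda>x. u x - psum a N x) \<in> sqint M" for N
    by (rule sqint_nn_boundI[OF _ bound]) simp
  \<comment> \<open>For \<open>N = 0\<close> the partial sum is empty, so the same bound yields
    square integrability of \<open>u\<close> itself.\<close>
  have u: "u \<in> sqint M"
    using d[of 0] by (simp add: psum_def)
  have "nsq M (\<lambda>x. u x - psum a N x) \<le> t N" for N
    by (rule nsq_le_nn[OF d bound t_nonneg])
  moreover have "t \<longlonglongrightarrow> 0"
    unfolding t_def using sm by (rule suminf_exist_split2)
  ultimately have "(\<lambda>N. nsq M (\<lambda>x. u x - psum a N x)) \<longlonglongrightarrow> 0"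
    by (rule tendsto_zero_le[OF nsq_nonneg])
  with u show ?thesis by (simp add: expands_def)
qed

text \<open>A subsequence of the partial sums with rapidly decaying increments converges almost
  everywhere; \<open>expands_pointwise\<close> then upgrades this to norm convergence of the whole
  series.\<close>

lemma Riesz_Fischer:
  assumes sm: "summable (\<lambda>n. (cmod (a n))\<^sup>2)"
  obtains u where "expands u a"
proof -
  have pm [measurable]: "psum a N \<in> borel_measurable M" for N
    using psum_sqint by (rule sqint_measurable)
  \<comment> \<open>The rate \<open>(1/4) ^ k\<close> leaves room for the weight
    \<open>2 ^ k\<close> used below: the weighted squared norms are still dominated by a geometric
    series of ratio 1/2.\<close>
  have "\<exists>N. \<forall>m\<ge>N. \<forall>n. norm (\<Sum>i\<in>{m..<n}. (cmod (a i))\<^sup>2) < (1/4) ^ k" for k :: nat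
    using sm unfolding summable_Cauchy by simp
  then obtain N where N: "\<And>k m n. m \<ge> N k \<Longrightarrow> norm (\<Sum>i\<in>{m..<n}. (cmod (a i))\<^sup>2) < (1/4) ^ k"
    by metis
  \<comment> \<open>Summing all earlier \<open>N j\<close> makes \<open>r\<close> monotone and keeps
    \<open>N k \<le> r k\<close>; the summand \<open>k\<close> makes it unbounded.\<close>
  define r where "r k = k + (\<Sum>j\<le>k. N j)" for k
  have rN: "N k \<le> r k" for k
    unfolding r_def by (simp add: trans_le_add2 member_le_sum)
  have r_Suc: "r k \<le> r (Suc k)" for k
    by (simp add: r_def)
  have r_top: "filterlim r at_top sequentially"
    by (rule filterlim_at_top_mono[OF filterlim_ident]) (auto simp: r_def)
  define B where "B k x = psum a (r (Suc k)) x - psum a (r k) x" for k x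
  have Bm [measurable]: "B k \<in> borel_measurable M" for k
    unfolding B_def[abs_def] by measurable
  have B_sqint: "B k \<in> sqint M" for k
    unfolding B_def[abs_def] by (intro sqint_diff psum_sqint)
  have B_nsq: "nsq M (B k) \<le> (1/4) ^ k" for k
    using N[OF rN[of k], of "r (Suc k)"] unfolding B_def[abs_def]
    by (simp add: nsq_psum_diff r_Suc sum_nonneg)
  have "(\<integral>\<^sup>+x. (\<Sum>k. ennreal (2 ^ k * (cmod (B k x))\<^sup>2)) \<partial>M) =
      (\<Sum>k. \<integral>\<^sup>+x. ennreal (2 ^ k * (cmod (B k x))\<^sup>2) \<partial>M)"
    by (rule nn_integral_suminf) measurable
  also have "\<dots> = (\<Sum>k. ennreal (2 ^ k * nsq M (B k)))"
    by (intro suminf_cong) (simp add: ennreal_mult' nn_integral_cmult nn_nsq[OF B_sqint])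
  also have "\<dots> \<le> (\<Sum>k. ennreal ((1/2) ^ k))"
  proof (intro suminf_le ennreal_leI)
    fix k
    have "2 ^ k * nsq M (B k) \<le> 2 ^ k * (1/4) ^ k"
      using B_nsq by simp
    also have "\<dots> = (1/2 :: real) ^ k"
      unfolding power_mult_distrib[symmetric] by simp
    finally show "2 ^ k * nsq M (B k) \<le> (1/2) ^ k" .
  qed auto
  also have "(\<Sum>k. ennreal ((1/2) ^ k)) = ennreal (\<Sum>k. (1/2) ^ k)"
    by (rule suminf_ennreal2) (auto intro: summable_geometric)
  also have "\<dots> < \<infinity>"
    by (simp only: infinity_ennreal_def ennreal_less_top)
  finally have fin: "AE x in M. (\<Sum>k. ennreal (2 ^ k * (cmod (B k x))\<^sup>2)) \<noteq> \<infinity>"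
    by (intro nn_integral_noteq_infinite) auto
  define u where "u x = lim (\<lambda>k. psum a (r k) x)" for x
  have um: "u \<in> borel_measurable M"
    unfolding u_def[abs_def] by measurable
  have lim: "AE x in M. (\<lambda>k. psum a (r k) x) \<longlonglongrightarrow> u x"
    using fin
  proof eventually_elim
    case (elim x)
    let ?S = "\<Sum>k. ennreal (2 ^ k * (cmod (B k x))\<^sup>2)"
    have sS: "summable (\<lambda>k. 2 ^ k * (cmod (B k x))\<^sup>2)"
      using elim by (intro summable_suminf_not_top) auto
    \<comment> \<open>Weighted arithmetic-geometric mean: \<open>cmod (B k x)\<close> is the product
      of \<open>sqrt ((1/2) ^ k)\<close> and \<open>sqrt (2 ^ k) * cmod (B k x)\<close>, so
      summability of the weighted squares gives that of the moduli.\<close>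
    have "summable (\<lambda>k. cmod (B k x))"
    proof (rule summable_comparison_test')
      show "summable (\<lambda>k. (1/2) ^ k + 2 ^ k * (cmod (B k x))\<^sup>2)"
        using sS by (intro summable_add summable_geometric) auto
      fix k :: nat
      have "2 * (sqrt ((1/2) ^ k) * (sqrt (2 ^ k) * cmod (B k x))) \<le>
          (1/2) ^ k + 2 ^ k * (cmod (B k x))\<^sup>2"
        using two_mult_le_squares[of "sqrt ((1/2) ^ k)" "sqrt (2 ^ k) * cmod (B k x)"]
        by (simp add: power_mult_distrib)
      moreover have "sqrt ((1/2) ^ k) * (sqrt (2 ^ k) * cmod (B k x)) = cmod (B k x)"
        by (simp add: mult.assoc[symmetric] real_sqrt_mult[symmetric]
            power_mult_distrib[symmetric])
      ultimately show "norm (cmod (B k x)) \<le> (1/2) ^ k + 2 ^ k * (cmod (B k x))\<^sup>2"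
        using norm_ge_zero[of "B k x"] unfolding real_norm_def abs_norm_cancel by linarith
    qed
    then have "summable (\<lambda>k. B k x)" by (rule summable_norm_cancel)
    then have "convergent (\<lambda>n. \<Sum>k<n. B k x)" by (simp add: summable_iff_convergent)
    moreover have "(\<Sum>k<n. B k x) = psum a (r n) x - psum a (r 0) x" for n
      unfolding B_def by (rule sum_lessThan_telescope)
    ultimately have "convergent (\<lambda>n. psum a (r n) x - psum a (r 0) x)" by simp
    then have "convergent (\<lambda>n. psum a (r n) x)"
      using convergent_add[OF _ convergent_const[of "psum a (r 0) x"]] by fastforce
    then show ?case unfolding u_def by (simp add: convergent_LIMSEQ_iff)
  qed
  show ?thesis
    by (rule that) (rule expands_pointwise[OF sm um r_top lim])
qed

end

section \<open>Hermite functions\<close>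

definition exp_growth :: "(real \<Rightarrow> real) \<Rightarrow> bool" where
  "exp_growth p \<longleftrightarrow> (\<exists>C k. \<forall>x. \<bar>p x\<bar> \<le> C * exp (k * \<bar>x\<bar>))"

lemma exp_growthE:
  assumes "exp_growth p"
  obtains C k where "0 \<le> C" "0 \<le> k" "\<And>x. \<bar>p x\<bar> \<le> C * exp (k * \<bar>x\<bar>)"
proof -
  obtain C k where *: "\<And>x. \<bar>p x\<bar> \<le> C * exp (k * \<bar>x\<bar>)"
    using assms by (auto simp: exp_growth_def)
  have "\<bar>p x\<bar> \<le> \<bar>C\<bar> * exp (\<bar>k\<bar> * \<bar>x\<bar>)" for x
  proof -
    have "C * exp (k * \<bar>x\<bar>) \<le> \<bar>C\<bar> * exp (\<bar>k\<bar> * \<bar>x\<bar>)"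
      by (intro mult_mono) (auto intro: mult_right_mono)
    with *[of x] show ?thesis by linarith
  qed
  then show ?thesis by (intro that[of "\<bar>C\<bar>" "\<bar>k\<bar>"]) auto
qed

lemma exp_growth_const: "exp_growth (\<lambda>x. c)"
  unfolding exp_growth_def by (intro exI[of _ "\<bar>c\<bar>"] exI[of _ 0]) simp

lemma exp_growth_ident: "exp_growth (\<lambda>x. x)"
  unfolding exp_growth_def
proof (intro exI[of _ 1] allI)
  show "\<bar>x\<bar> \<le> 1 * exp (1 * \<bar>x\<bar>)" for x :: real
    using exp_ge_add_one_self[of "\<bar>x\<bar>"] unfolding mult_1 by linarith
qed

lemma exp_growth_exp: "exp_growth (\<lambda>x. exp (k * \<bar>x\<bar>))"
  unfolding exp_growth_def by (intro exI[of _ 1] exI[of _ k]) simp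

lemma exp_growth_mult:
  assumes "exp_growth f" "exp_growth g" shows "exp_growth (\<lambda>x. f x * g x)"
proof -
  obtain C k where f: "0 \<le> C" "\<And>x. \<bar>f x\<bar> \<le> C * exp (k * \<bar>x\<bar>)"
    using exp_growthE[OF assms(1)] by metis
  obtain D l where g: "\<And>x. \<bar>g x\<bar> \<le> D * exp (l * \<bar>x\<bar>)"
    using exp_growthE[OF assms(2)] by metis
  have "\<bar>f x * g x\<bar> \<le> (C * D) * exp ((k + l) * \<bar>x\<bar>)" for x
  proof -
    have "\<bar>f x * g x\<bar> \<le> (C * exp (k * \<bar>x\<bar>)) * (D * exp (l * \<bar>x\<bar>))"
      unfolding abs_mult using f g by (intro mult_mono) auto
    then show ?thesis unfolding distrib_right exp_add by (simp only: mult_ac)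
  qed
  then show ?thesis unfolding exp_growth_def by blast
qed

lemma exp_growth_add:
  assumes "exp_growth f" "exp_growth g" shows "exp_growth (\<lambda>x. f x + g x)"
proof -
  obtain C k where f: "0 \<le> C" "0 \<le> k" "\<And>x. \<bar>f x\<bar> \<le> C * exp (k * \<bar>x\<bar>)"
    using exp_growthE[OF assms(1)] by metis
  obtain D l where g: "0 \<le> D" "0 \<le> l" "\<And>x. \<bar>g x\<bar> \<le> D * exp (l * \<bar>x\<bar>)"
    using exp_growthE[OF assms(2)] by metis
  have "\<bar>f x + g x\<bar> \<le> (C + D) * exp ((k + l) * \<bar>x\<bar>)" for x
  proof -
    have "C * exp (k * \<bar>x\<bar>) \<le> C * exp ((k + l) * \<bar>x\<bar>)"
         "D * exp (l * \<bar>x\<bar>) \<le> D * exp ((k + l) * \<bar>x\<bar>)"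
      using f g by (auto intro!: mult_left_mono mult_right_mono)
    with f(3)[of x] g(3)[of x] show ?thesis
      using abs_triangle_ineq[of "f x" "g x"] unfolding distrib_right[of C D] by linarith
  qed
  then show ?thesis unfolding exp_growth_def by blast
qed

lemma exp_growth_power: "exp_growth (\<lambda>x. x ^ k)"
  by (induction k) (auto intro: exp_growth_const exp_growth_mult exp_growth_ident)

text \<open>Completing the square gives
  \<open>k * \<bar>x\<bar> \<le> k\<^sup>2 + x\<^sup>2 / 4\<close>, so half of the Gaussian exponent
  absorbs the growth. The class is wide enough for polynomials, in the integrations by parts, and
  for \<open>exp (\<bar>t\<bar> * \<bar>x\<bar>)\<close>, which dominates the exponential series in
  the Fourier argument.\<close>

lemma exp_growth_gauss_bound:
  assumes "exp_growth p"
  obtains C where "\<And>x. \<bar>p x * exp (- x\<^sup>2 / 2)\<bar> \<le> C * exp (- x\<^sup>2 / 4)"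
proof -
  obtain C k where f: "0 \<le> C" "0 \<le> k" "\<And>x. \<bar>p x\<bar> \<le> C * exp (k * \<bar>x\<bar>)"
    using exp_growthE[OF assms] by metis
  have "\<bar>p x * exp (- x\<^sup>2 / 2)\<bar> \<le> C * exp (k\<^sup>2) * exp (- x\<^sup>2 / 4)" for x
  proof -
    have "k * \<bar>x\<bar> \<le> k\<^sup>2 + x\<^sup>2 / 4"
      using two_mult_le_squares[of k "\<bar>x\<bar> / 2"] by (simp add: power_divide)
    then have "C * exp (k * \<bar>x\<bar>) \<le> C * exp (k\<^sup>2 + x\<^sup>2 / 4)"
      using f by (intro mult_left_mono) auto
    then have "\<bar>p x\<bar> \<le> C * exp (k\<^sup>2 + x\<^sup>2 / 4)" using f(3)[of x] by linarith
    then have "\<bar>p x\<bar> * exp (- x\<^sup>2 / 2) \<le> C * exp (k\<^sup>2 + x\<^sup>2 / 4) * exp (- x\<^sup>2 / 2)"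
      by (intro mult_right_mono) auto
    also have "\<dots> = C * exp (k\<^sup>2) * exp (- x\<^sup>2 / 4)"
      by (simp add: mult.assoc exp_add[symmetric])
    finally show ?thesis by (simp add: abs_mult)
  qed
  then show ?thesis by (rule that)
qed

lemma exp_growth_gauss_integrable:
  assumes "exp_growth p" and [measurable]: "p \<in> borel_measurable borel"
  shows "integrable lborel (\<lambda>x. p x * exp (- x\<^sup>2 / 2))"
proof -
  obtain C where C: "\<And>x. \<bar>p x * exp (- x\<^sup>2 / 2)\<bar> \<le> C * exp (- x\<^sup>2 / 4)"
    using exp_growth_gauss_bound[OF assms(1)] by metis
  have "integrable lborel (\<lambda>x. sqrt (2 * pi * (sqrt 2)\<^sup>2) * normal_density 0 (sqrt 2) x)"
    by (intro integrable_mult_right impI integrable_normal_density) simp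
  then have "integrable lborel (\<lambda>x::real. exp (- x\<^sup>2 / 4))"
    by (simp add: normal_density_def)
  then have "integrable lborel (\<lambda>x. C * exp (- x\<^sup>2 / 4))" by simp
  then show ?thesis
    by (rule Bochner_Integration.integrable_bound)
      (use C in \<open>auto intro!: AE_I2 intro: order_trans[OF _ abs_ge_self]\<close>)
qed

lemma exp_growth_gauss_tendsto:
  assumes "exp_growth p"
  shows "((\<lambda>x. p x * exp (- x\<^sup>2 / 2)) \<longlongrightarrow> 0) at_top"
    and "((\<lambda>x. p x * exp (- x\<^sup>2 / 2)) \<longlongrightarrow> 0) at_bot"
proof -
  obtain C where C: "\<And>x. \<bar>p x * exp (- x\<^sup>2 / 2)\<bar> \<le> C * exp (- x\<^sup>2 / 4)"
    using exp_growth_gauss_bound[OF assms(1)] by metis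
  have "((\<lambda>x. C * exp (- x\<^sup>2 / 4)) \<longlongrightarrow> 0) at_top" by real_asymp
  then show "((\<lambda>x. p x * exp (- x\<^sup>2 / 2)) \<longlongrightarrow> 0) at_top"
    by (rule Lim_null_comparison[rotated]) (use C in simp)
  have "((\<lambda>x. C * exp (- x\<^sup>2 / 4)) \<longlongrightarrow> 0) at_bot" by real_asymp
  then show "((\<lambda>x. p x * exp (- x\<^sup>2 / 2)) \<longlongrightarrow> 0) at_bot"
    by (rule Lim_null_comparison[rotated]) (use C in simp)
qed

section \<open>Hermite polynomials and orthonormality of the Hermite functions\<close>

lemma integral_deriv_eq_0:
  fixes F f :: "real \<Rightarrow> real"
  assumes F: "\<And>x. (F has_real_derivative f x) (at x)"
    and f: "\<And>x. isCont f x" "integrable lborel f"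
    and lim: "(F \<longlongrightarrow> 0) at_top" "(F \<longlongrightarrow> 0) at_bot"
  shows "(LINT x|lborel. f x) = 0"
proof -
  have "(LBINT x=-\<infinity>..\<infinity>. f x) = 0 - 0"
  proof (rule interval_integral_FTC_integrable)
    show "((F \<circ> real_of_ereal) \<longlongrightarrow> 0) (at_right (-\<infinity>))"
      using lim(2) by (simp add: ereal_tendsto_simps)
    show "((F \<circ> real_of_ereal) \<longlongrightarrow> 0) (at_left \<infinity>)"
      using lim(1) by (simp add: ereal_tendsto_simps)
  qed (use F f in \<open>auto simp: has_real_derivative_iff_has_vector_derivative set_integrable_def\<close>)
  then show ?thesis
    by (simp add: interval_lebesgue_integral_def set_lebesgue_integral_def)
qed

text \<open>A single recurrence for all \<open>n\<close>: at \<open>n = 0\<close> the truncated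
  index \<open>n - 1\<close> is harmless because of the factor \<open>real n\<close>.\<close>

lemma hermite_Suc: "hermite (Suc n) x = 2 * x * hermite n x - 2 * real n * hermite (n - 1) x"
  by (cases n) simp_all

lemma hermite_has_derivative:
  "(hermite n has_real_derivative 2 * real n * hermite (n - 1) x) (at x)"
proof (induction n x rule: hermite.induct)
  case (3 n x)
  have e: "hermite (Suc (Suc n)) = (\<lambda>x. 2 * x * hermite (Suc n) x - 2 * real (Suc n) * hermite n x)"
    by (simp add: fun_eq_iff)
  show ?case
    unfolding e by (rule derivative_eq_intros 3 refl)+
      (simp add: hermite_Suc[of n] algebra_simps)
next
  case (1 x)
  have "hermite 0 = (\<lambda>x. 1)" by (simp add: fun_eq_iff)
  then show ?case by simp
next
  case (2 x)
  have "hermite (Suc 0) = (\<lambda>x. 2 * x)" by (simp add: fun_eq_iff)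
  then show ?case by (auto intro!: derivative_eq_intros)
qed

lemma hermite_continuous [continuous_intros]: "isCont (hermite n) x"
  using hermite_has_derivative by (rule DERIV_isCont)

lemma hermite_measurable [measurable]: "hermite n \<in> borel_measurable borel"
  by (rule borel_measurable_continuous_onI)
    (simp add: continuous_at_imp_continuous_on hermite_continuous)

lemma exp_growth_hermite: "exp_growth (hermite n)"
proof (induction n rule: less_induct)
  case (less n)
  show ?case
  proof (cases n)
    case 0
    then have "hermite n = (\<lambda>x. 1)" by (simp add: fun_eq_iff)
    then show ?thesis by (simp add: exp_growth_const)
  next
    case (Suc m)
    then have e: "hermite n = (\<lambda>x. (2 * x) * hermite m x + (- (2 * real m)) * hermite (m - 1) x)"
      by (simp add: fun_eq_iff hermite_Suc)
    show ?thesis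
      unfolding e using Suc
      by (intro exp_growth_add exp_growth_mult exp_growth_const exp_growth_ident less) auto
  qed
qed

lemma gauss_split: "exp (- x\<^sup>2) = exp (- x\<^sup>2 / 2) * exp (- x\<^sup>2 / 2 :: real)"
  by (simp add: exp_add[symmetric])

lemma exp_growth_gauss: "exp_growth (\<lambda>x. exp (- x\<^sup>2 / 2))"
  unfolding exp_growth_def by (intro exI[of _ 1] exI[of _ 0]) simp

lemma hermite_prod_integrable: "integrable lborel (\<lambda>x. hermite m x * hermite n x * exp (- x\<^sup>2))"
proof -
  have "integrable lborel (\<lambda>x. (hermite m x * hermite n x * exp (- x\<^sup>2 / 2)) * exp (- x\<^sup>2 / 2))"
    by (intro exp_growth_gauss_integrable exp_growth_mult exp_growth_hermite exp_growth_gauss) simp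
  then show ?thesis by (simp only: gauss_split mult.assoc)
qed

text \<open>The derivative of \<open>hermite n x * exp (- x\<^sup>2)\<close> is
  \<open>- hermite (Suc n) x * exp (- x\<^sup>2)\<close>, so this is integration by parts. Lowering
  both indices at once reduces orthogonality to the case where one of them is 0.\<close>

lemma hermite_integral_Suc:
  "(LINT x|lborel. hermite m x * hermite (Suc n) x * exp (- x\<^sup>2)) =
    2 * real m * (LINT x|lborel. hermite (m - 1) x * hermite n x * exp (- x\<^sup>2))"
proof -
  let ?F = "\<lambda>x. hermite m x * hermite n x * exp (- x\<^sup>2)"
  let ?f = "\<lambda>x. 2 * real m * (hermite (m - 1) x * hermite n x * exp (- x\<^sup>2)) -
      hermite m x * hermite (Suc n) x * exp (- x\<^sup>2)"
  have F: "?F = (\<lambda>x. (hermite m x * hermite n x * exp (- x\<^sup>2 / 2)) * exp (- x\<^sup>2 / 2))"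
    by (simp only: gauss_split mult.assoc)
  have "(LINT x|lborel. ?f x) = 0"
  proof (rule integral_deriv_eq_0)
    show "(?F has_real_derivative ?f x) (at x)" for x
      by (rule derivative_eq_intros hermite_has_derivative refl)+
        (simp add: hermite_Suc[of n] algebra_simps)
    show "isCont ?f x" for x
      by (intro continuous_intros)
    show "integrable lborel ?f"
      by (intro Bochner_Integration.integrable_diff integrable_mult_right impI hermite_prod_integrable)
    show "(?F \<longlongrightarrow> 0) at_top" "(?F \<longlongrightarrow> 0) at_bot"
      unfolding F by (intro exp_growth_gauss_tendsto exp_growth_mult exp_growth_hermite exp_growth_gauss)+
  qed
  then show ?thesis
    by (simp add: hermite_prod_integrable del: hermite.simps)
qed

lemma integral_gauss: "(LINT x|lborel. exp (- x\<^sup>2)) = sqrt pi"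
  using has_bochner_integral_even_function[OF gaussian_moment_0]
  by (simp add: has_bochner_integral_iff)

lemma hermite_orthogonal:
  "(LINT x|lborel. hermite m x * hermite n x * exp (- x\<^sup>2)) =
    (if m = n then 2 ^ n * fact n * sqrt pi else 0)"
proof (induction n arbitrary: m)
  case 0
  show ?case
  proof (cases m)
    case 0
    then show ?thesis by (simp add: integral_gauss)
  next
    \<comment> \<open>The roles of the two indices are exchanged: the factor \<open>real 0\<close>
      in the lowering identity annihilates the integral.\<close>
    case (Suc k)
    then show ?thesis
      using hermite_integral_Suc[of 0 k] by (simp del: hermite.simps add: mult.commute)
  qed
next
  case (Suc n)
  show ?case
    unfolding hermite_integral_Suc Suc by (cases m) auto
qed

lemma hermite_fun_measurable [measurable]: "hermite_fun n \<in> borel_measurable borel"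
  unfolding hermite_fun_def[abs_def] by measurable

lemma hermite_fun_prod:
  "hermite_fun m x * hermite_fun n x =
    hermite m x * hermite n x * exp (- x\<^sup>2) /
    (sqrt (2 ^ m * fact m * sqrt pi) * sqrt (2 ^ n * fact n * sqrt pi))"
  by (simp add: hermite_fun_def gauss_split)

lemma hermite_fun_prod_integrable: "integrable lborel (\<lambda>x. hermite_fun m x * hermite_fun n x)"
  unfolding hermite_fun_prod using hermite_prod_integrable by simp

lemma hermite_fun_orthonormal:
  "(LINT x|lborel. hermite_fun m x * hermite_fun n x) = (if m = n then 1 else 0)"
  unfolding hermite_fun_prod by (simp add: hermite_orthogonal)

definition psi :: "nat \<Rightarrow> real \<Rightarrow> complex" where
  "psi n x = complex_of_real (hermite_fun n x)"

interpretation herm: orthonormal_seq lborel psi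
proof
  show "psi n \<in> sqint lborel" for n
    using hermite_fun_prod_integrable[of n n]
    by (simp add: sqint_def psi_def[abs_def] power2_eq_square)
  have "ip lborel (psi m) (psi n) = complex_of_real (LINT x|lborel. hermite_fun m x * hermite_fun n x)" for m n
    unfolding ip_def psi_def integral_complex_of_real[symmetric] by simp
  then show "ip lborel (psi m) (psi n) = (if m = n then 1 else 0)" for m n
    by (simp add: hermite_fun_orthonormal)
qed

text \<open>After normalization the three-term recurrence has coefficients of modulus at most
  \<open>2 * \<bar>x\<bar>\<close> and 1. The resulting bound is crude but only geometric in
  \<open>n\<close>, and the Gamma values in the kernel outgrow every geometric sequence.\<close>

lemma hermite_fun_le: "\<bar>hermite_fun n x\<bar> \<le> (1 + 2 * \<bar>x\<bar>) ^ n"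
proof (induction n rule: less_induct)
  case (less n)
  define c where "c n = sqrt (2 ^ n * fact n * sqrt pi)" for n
  have c_pos: "c n > 0" for n by (simp add: c_def)
  have cSuc: "c (Suc n) = sqrt (2 * real (Suc n)) * c n" for n
    by (simp add: c_def real_sqrt_mult[symmetric] mult_ac)
  have pi1: "1 \<le> sqrt (sqrt pi)" using pi_ge_two by simp
  show ?case
  proof (cases n)
    case 0
    have "exp (- x\<^sup>2 / 2) \<le> 1" by simp
    then have "exp (- x\<^sup>2 / 2) \<le> sqrt (sqrt pi)" using pi1 by linarith
    then show ?thesis using 0 pi1 by (simp add: hermite_fun_def)
  next
    case (Suc m)
    have s: "sqrt (2 * real (Suc m)) > 0" by simp
    have a: "\<bar>2 * x * hermite m x * exp (- x\<^sup>2 / 2) / c (Suc m)\<bar> \<le> 2 * \<bar>x\<bar> * \<bar>hermite_fun m x\<bar>"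
    proof -
      have "1 \<le> sqrt (2 * real (Suc m))" by simp
      then have "c m \<le> c (Suc m)" using c_pos[of m] by (simp add: cSuc)
      then have "\<bar>2 * x * hermite m x * exp (- x\<^sup>2 / 2)\<bar> / c (Suc m) \<le>
          \<bar>2 * x * hermite m x * exp (- x\<^sup>2 / 2)\<bar> / c m"
        using c_pos by (intro divide_left_mono) auto
      then show ?thesis
        using c_pos[of m] c_pos[of "Suc m"] unfolding hermite_fun_def c_def[symmetric]
        by (simp add: abs_mult abs_divide)
    qed
    have b: "\<bar>2 * real m * hermite (m - 1) x * exp (- x\<^sup>2 / 2) / c (Suc m)\<bar> \<le> \<bar>hermite_fun (m - 1) x\<bar>"
    proof (cases m)
      case (Suc k)
      have "2 * real m \<le> sqrt (2 * real (Suc m)) * sqrt (2 * real m)"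
        by (simp add: real_sqrt_mult[symmetric] real_le_rsqrt power2_eq_square algebra_simps)
      then have "2 * real m * c k \<le> c (Suc m)"
        using c_pos[of k] Suc by (simp add: cSuc mult.assoc[symmetric] del: of_nat_Suc)
      then have "2 * real m / c (Suc m) \<le> 1 / c k"
        using c_pos[of k] c_pos[of "Suc m"] by (simp add: field_simps)
      then have "2 * real m / c (Suc m) * \<bar>hermite k x * exp (- x\<^sup>2 / 2)\<bar> \<le>
          1 / c k * \<bar>hermite k x * exp (- x\<^sup>2 / 2)\<bar>"
        by (rule mult_right_mono) simp
      then show ?thesis
        using c_pos[of k] c_pos[of "Suc m"] Suc unfolding hermite_fun_def c_def[symmetric]
        by (simp add: abs_mult abs_divide mult_ac)
    qed simp
    have "hermite_fun n x = 2 * x * hermite m x * exp (- x\<^sup>2 / 2) / c (Suc m) -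
        2 * real m * hermite (m - 1) x * exp (- x\<^sup>2 / 2) / c (Suc m)"
      unfolding Suc hermite_fun_def c_def[symmetric] hermite_Suc
      by (simp add: left_diff_distrib diff_divide_distrib)
    then have "\<bar>hermite_fun n x\<bar> \<le> 2 * \<bar>x\<bar> * \<bar>hermite_fun m x\<bar> + \<bar>hermite_fun (m - 1) x\<bar>"
      by (simp only: order_trans[OF abs_triangle_ineq4 add_mono[OF a b]])
    also have "\<dots> \<le> 2 * \<bar>x\<bar> * (1 + 2 * \<bar>x\<bar>) ^ m + (1 + 2 * \<bar>x\<bar>) ^ m"
    proof (intro add_mono mult_left_mono)
      show "\<bar>hermite_fun m x\<bar> \<le> (1 + 2 * \<bar>x\<bar>) ^ m" using less Suc by simp
      have "\<bar>hermite_fun (m - 1) x\<bar> \<le> (1 + 2 * \<bar>x\<bar>) ^ (m - 1)" using less Suc by simp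
      also have "\<dots> \<le> (1 + 2 * \<bar>x\<bar>) ^ m" by (intro power_increasing) auto
      finally show "\<bar>hermite_fun (m - 1) x\<bar> \<le> (1 + 2 * \<bar>x\<bar>) ^ m" .
    qed simp
    also have "\<dots> = (1 + 2 * \<bar>x\<bar>) ^ n" by (simp add: Suc algebra_simps)
    finally show ?thesis .
  qed
qed

text \<open>If \<open>u\<close> is orthogonal to all Hermite functions, then all moments of \<open>u(x) exp (- x\<^sup>2 / 2)\<close>
  vanish, hence so does its Fourier transform; Levy's uniqueness theorem is applied to the
  normalized positive and negative parts.\<close>

lemma hermite_complete_real:
  fixes u :: "real \<Rightarrow> real"
  assumes um [measurable]: "u \<in> borel_measurable borel"
    and u2: "integrable lborel (\<lambda>x. (u x)\<^sup>2)"
    and orth: "\<And>n. (LINT x|lborel. u x * hermite_fun n x) = 0"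
  shows "AE x in lborel. u x = 0"
proof -
  define g where "g x = u x * exp (- x\<^sup>2 / 2)" for x
  have gm [measurable]: "g \<in> borel_measurable borel"
    unfolding g_def[abs_def] by measurable
  \<comment> \<open>As \<open>u\<close> is merely square integrable, the product is dominated by
    \<open>(u x)\<^sup>2\<close> plus the square of
    \<open>p x * exp (- x\<^sup>2 / 2)\<close>.\<close>
  have int: "integrable lborel (\<lambda>x. g x * p x)"
    if p: "exp_growth p" and [measurable]: "p \<in> borel_measurable borel" for p
  proof (rule Bochner_Integration.integrable_bound)
    have "integrable lborel (\<lambda>x. (p x * p x * exp (- x\<^sup>2 / 2)) * exp (- x\<^sup>2 / 2))"
      by (intro exp_growth_gauss_integrable exp_growth_mult p exp_growth_gauss) simp
    then show "integrable lborel (\<lambda>x. (u x)\<^sup>2 + (p x * p x * exp (- x\<^sup>2 / 2)) * exp (- x\<^sup>2 / 2))"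
      using u2 by (intro Bochner_Integration.integrable_add)
    show "AE x in lborel. norm (g x * p x) \<le>
        norm ((u x)\<^sup>2 + (p x * p x * exp (- x\<^sup>2 / 2)) * exp (- x\<^sup>2 / 2))"
    proof (intro AE_I2)
      fix x
      define y where "y = p x * exp (- x\<^sup>2 / 2)"
      have "2 * (\<bar>u x\<bar> * \<bar>y\<bar>) \<le> (u x)\<^sup>2 + y\<^sup>2"
        using two_mult_le_squares[of "\<bar>u x\<bar>" "\<bar>y\<bar>"] by simp
      moreover have "0 \<le> \<bar>u x\<bar> * \<bar>y\<bar>" by simp
      moreover have a: "\<bar>g x * p x\<bar> = \<bar>u x\<bar> * \<bar>y\<bar>"
        by (simp add: g_def y_def abs_mult)
      moreover have b: "(p x * p x * exp (- x\<^sup>2 / 2)) * exp (- x\<^sup>2 / 2) = y\<^sup>2"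
        by (simp add: y_def power2_eq_square)
      ultimately show "norm (g x * p x) \<le>
          norm ((u x)\<^sup>2 + (p x * p x * exp (- x\<^sup>2 / 2)) * exp (- x\<^sup>2 / 2))"
        unfolding real_norm_def a b by linarith
    qed
  qed simp
  have intg: "integrable lborel g"
    using int[OF exp_growth_const, of 1] by simp
  have intpow: "integrable lborel (\<lambda>x. g x * x ^ k)" for k
    by (rule int[OF exp_growth_power]) simp
  \<comment> \<open>A factor \<open>x\<close> is traded for a shift of the Hermite index through
    \<open>2 * x * hermite n x = hermite (Suc n) x + 2 * real n * hermite (n - 1) x\<close>. This is
    why the induction on \<open>k\<close> keeps \<open>n\<close> arbitrary; taking
    \<open>n = 0\<close> at the end leaves the plain moments.\<close>
  have "(LINT x|lborel. g x * (x ^ k * hermite n x)) = 0" for k n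
  proof (induction k arbitrary: n)
    case 0
    have "(LINT x|lborel. g x * hermite n x) =
        (LINT x|lborel. sqrt (2 ^ n * fact n * sqrt pi) * (u x * hermite_fun n x))"
      by (intro Bochner_Integration.integral_cong) (simp_all add: g_def hermite_fun_def)
    then show ?case using orth[of n] by simp
  next
    case (Suc k)
    have i: "integrable lborel (\<lambda>x. g x * (x ^ k * hermite n x))" for n
      by (intro int exp_growth_mult exp_growth_power exp_growth_hermite) simp
    have "(LINT x|lborel. g x * (x ^ Suc k * hermite n x)) =
        (LINT x|lborel. 1/2 * (g x * (x ^ k * hermite (Suc n) x)) +
          real n * (g x * (x ^ k * hermite (n - 1) x)))"
      by (intro Bochner_Integration.integral_cong)
        (simp_all add: hermite_Suc[of n] algebra_simps del: hermite.simps)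
    also have "\<dots> = 1/2 * (LINT x|lborel. g x * (x ^ k * hermite (Suc n) x)) +
        real n * (LINT x|lborel. g x * (x ^ k * hermite (n - 1) x))"
      by (simp add: i del: hermite.simps)
    finally show ?case using Suc by simp
  qed
  from this[of _ 0] have moments: "(LINT x|lborel. g x * x ^ k) = 0" for k by simp
  \<comment> \<open>The partial sums of the exponential series are polynomials in \<open>x\<close>,
    so their integrals against \<open>g\<close> vanish; the dominating function
    \<open>g x * exp (\<bar>t\<bar> * \<bar>x\<bar>)\<close> permits passing to the limit.\<close>
  have fourier: "(CLINT x|lborel. complex_of_real (g x) * iexp (t * x)) = 0" for t
  proof -
    define z where "z x = \<i> * complex_of_real (t * x)" for x
    define s where "s N x = (\<Sum>k<N. (\<i> * complex_of_real t) ^ k / fact k * complex_of_real (g x * x ^ k))" for N x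
    have s_eq: "s N x = complex_of_real (g x) * (\<Sum>k<N. z x ^ k / fact k)" for N x
      unfolding s_def z_def sum_distrib_left
      by (intro sum.cong) (simp_all add: power_mult_distrib)
    have "(\<lambda>N. CLINT x|lborel. s N x) \<longlonglongrightarrow> (CLINT x|lborel. complex_of_real (g x) * exp (z x))"
    proof (rule integral_dominated_convergence)
      show "(\<lambda>x. complex_of_real (g x) * exp (z x)) \<in> borel_measurable lborel"
        unfolding z_def by measurable
      show "s N \<in> borel_measurable lborel" for N
        unfolding s_def[abs_def] by measurable
      show "integrable lborel (\<lambda>x. \<bar>g x * exp (\<bar>t\<bar> * \<bar>x\<bar>)\<bar>)"
        by (intro integrable_abs int exp_growth_exp) simp
      show "AE x in lborel. (\<lambda>N. s N x) \<longlonglongrightarrow> complex_of_real (g x) * exp (z x)"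
      proof (intro AE_I2)
        fix x
        have "(\<lambda>k. z x ^ k / fact k) sums exp (z x)"
          using exp_converges[of "z x"] by (simp add: scaleR_conv_of_real divide_inverse mult.commute)
        then show "(\<lambda>N. s N x) \<longlonglongrightarrow> complex_of_real (g x) * exp (z x)"
          unfolding s_eq sums_def by (intro tendsto_intros)
      qed
      show "AE x in lborel. norm (s N x) \<le> \<bar>g x * exp (\<bar>t\<bar> * \<bar>x\<bar>)\<bar>" for N
      proof (intro AE_I2)
        fix x
        have "norm (\<Sum>k<N. z x ^ k / fact k) \<le> (\<Sum>k<N. norm (z x) ^ k / fact k)"
          by (intro order_trans[OF norm_sum] sum_mono) (simp add: norm_divide norm_power)
        also have "\<dots> \<le> exp (norm (z x))"
        proof -
          have "(\<lambda>k. norm (z x) ^ k / fact k) sums exp (norm (z x))"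
            using exp_converges[of "norm (z x)"] by (simp add: divide_inverse mult.commute)
          then show ?thesis
            unfolding sums_iff by (metis (no_types, lifting) sum_le_suminf[OF _ finite_lessThan]
                divide_nonneg_nonneg fact_ge_zero norm_ge_zero zero_le_power)
        qed
        also have "norm (z x) = \<bar>t\<bar> * \<bar>x\<bar>"
          by (simp add: z_def norm_mult)
        finally show "norm (s N x) \<le> \<bar>g x * exp (\<bar>t\<bar> * \<bar>x\<bar>)\<bar>"
          unfolding s_eq norm_mult abs_mult by (auto intro!: mult_left_mono)
      qed
    qed
    moreover have "(CLINT x|lborel. s N x) = 0" for N
    proof -
      have "(CLINT x|lborel. s N x) =
          (\<Sum>k<N. (\<i> * complex_of_real t) ^ k / fact k * complex_of_real (LINT x|lborel. g x * x ^ k))"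
        unfolding s_def
        by (subst Bochner_Integration.integral_sum)
          (auto intro!: integrable_mult_right integrable_of_real intpow
            simp del: of_real_mult simp: integral_complex_of_real)
      then show ?thesis by (simp add: moments)
    qed
    ultimately have "(CLINT x|lborel. complex_of_real (g x) * exp (z x)) = 0"
      by (simp add: LIMSEQ_const_iff)
    then show ?thesis by (simp add: z_def mult_ac)
  qed
  define gp where "gp x = max 0 (g x)" for x
  define gn where "gn x = max 0 (- g x)" for x
  have [measurable]: "gp \<in> borel_measurable borel" "gn \<in> borel_measurable borel"
    unfolding gp_def[abs_def] gn_def[abs_def] by measurable
  have ip: "integrable lborel gp" "integrable lborel gn"
    unfolding gp_def[abs_def] gn_def[abs_def] using intg by auto
  have gdiff: "g x = gp x - gn x" for x by (simp add: gp_def gn_def)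
  have nonneg: "gp x \<ge> 0" "gn x \<ge> 0" for x by (simp_all add: gp_def gn_def)
  \<comment> \<open>By the vanishing zeroth moment both parts have the same mass, so one constant
    normalizes both to probability densities. Only \<open>c = 0\<close> escapes the normalization,
    and then both parts vanish almost everywhere.\<close>
  define c where "c = (LINT x|lborel. gp x)"
  have c: "(LINT x|lborel. gn x) = c"
    using moments[of 0] ip by (simp add: gdiff c_def)
  have c0: "c \<ge> 0" unfolding c_def using nonneg by simp
  have "AE x in lborel. gp x = gn x"
  proof (cases "c = 0")
    case True
    then have "AE x in lborel. gp x = 0"
      using integral_nonneg_eq_0_iff_AE[OF ip(1)] nonneg by (simp add: c_def)
    moreover have "AE x in lborel. gn x = 0"
      using integral_nonneg_eq_0_iff_AE[OF ip(2)] nonneg c True by simp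
    ultimately show ?thesis by eventually_elim simp
  next
    case False
    with c0 have cpos: "c > 0" by simp
    define D where "D h = density lborel (\<lambda>x::real. ennreal (h x / c))" for h
    have rd: "real_distribution (D h)"
      if [measurable]: "h \<in> borel_measurable borel" and "integrable lborel h" "\<And>x. h x \<ge> 0"
        "(LINT x|lborel. h x) = c" for h
    proof -
      have "emeasure (D h) (space (D h)) = (\<integral>\<^sup>+x. ennreal (h x / c) \<partial>lborel)"
        unfolding D_def by (subst emeasure_density) auto
      also have "\<dots> = ennreal (LINT x|lborel. h x / c)"
        using that cpos by (intro nn_integral_eq_integral) auto
      also have "\<dots> = 1" using that cpos by simp
      finally have "prob_space (D h)" by (rule prob_spaceI)
      then show ?thesis
        by (simp add: real_distribution_def real_distribution_axioms_def D_def)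
    qed
    have ch: "char (D h) t = (CLINT x|lborel. complex_of_real (h x) * iexp (t * x)) / c"
      if [measurable]: "h \<in> borel_measurable borel" and "\<And>x. h x \<ge> 0" for h t
    proof -
      have "char (D h) t = (CLINT x|lborel. (h x / c) *\<^sub>R iexp (t * x))"
        unfolding char_def D_def using that cpos by (subst integral_density) auto
      also have "\<dots> = (CLINT x|lborel. (complex_of_real (h x) * iexp (t * x)) / c)"
        by (intro Bochner_Integration.integral_cong) (simp_all add: scaleR_conv_of_real)
      finally show ?thesis by simp
    qed
    have iexp_int: "integrable lborel (\<lambda>x. complex_of_real (h x) * iexp (t * x))"
      if [measurable]: "h \<in> borel_measurable borel" and "integrable lborel h" for h t
      by (rule Bochner_Integration.integrable_bound[OF that(2)]) (auto simp: norm_mult)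
    have "char (D gp) = char (D gn)"
    proof
      fix t
      have "(CLINT x|lborel. complex_of_real (gp x) * iexp (t * x)) -
          (CLINT x|lborel. complex_of_real (gn x) * iexp (t * x)) =
          (CLINT x|lborel. complex_of_real (gp x) * iexp (t * x) -
            complex_of_real (gn x) * iexp (t * x))"
        by (intro Bochner_Integration.integral_diff[symmetric] iexp_int ip) simp_all
      also have "\<dots> = 0"
        using fourier[of t] by (simp only: gdiff of_real_diff left_diff_distrib)
      finally have "(CLINT x|lborel. complex_of_real (gp x) * iexp (t * x)) =
          (CLINT x|lborel. complex_of_real (gn x) * iexp (t * x))" by simp
      then show "char (D gp) t = char (D gn) t"
        by (simp add: ch nonneg)
    qed
    then have "D gp = D gn"
      by (intro Levy_uniqueness rd ip nonneg c) (simp_all add: c_def)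
    then have "AE x in lborel. ennreal (gp x / c) = ennreal (gn x / c)"
      unfolding D_def by (intro sigma_finite_measure.density_unique[OF sigma_finite_lborel]) auto
    then show ?thesis
      by eventually_elim (use cpos nonneg in \<open>simp add: divide_nonneg_pos\<close>)
  qed
  then show ?thesis
    by eventually_elim (metis gdiff g_def diff_self exp_not_eq_zero mult_eq_0_iff)
qed

text \<open>The Hermite functions are real, so orthogonality passes to the real and imaginary parts
  separately.\<close>

lemma hermite_complete:
  assumes u: "u \<in> sqint lborel"
    and orth: "\<And>n. ip lborel u (psi n) = 0"
  shows "AE x in lborel. u x = 0"
proof -
  have um [measurable]: "u \<in> borel_measurable borel" using u by (simp add: sqint_def)
  have prod: "integrable lborel (\<lambda>x. u x * complex_of_real (hermite_fun n x))" for n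
    using sqint_mult_integrable[OF u herm.e_sqint[of n]] by (simp add: psi_def)
  have z: "(LINT x|lborel. u x * complex_of_real (hermite_fun n x)) = 0" for n
    using orth[of n] by (simp add: ip_def psi_def)
  have sq: "integrable lborel (\<lambda>x. (Re (u x))\<^sup>2)" "integrable lborel (\<lambda>x. (Im (u x))\<^sup>2)"
    by (rule Bochner_Integration.integrable_bound[OF sqint_integrable[OF u]];
        auto simp: cmod_def)+
  have "AE x in lborel. Re (u x) = 0"
  proof (rule hermite_complete_real[OF _ sq(1)])
    show "(LINT x|lborel. Re (u x) * hermite_fun n x) = 0" for n
      using integral_Re[OF prod[of n]] by (simp add: z)
  qed simp
  moreover have "AE x in lborel. Im (u x) = 0"
  proof (rule hermite_complete_real[OF _ sq(2)])
    show "(LINT x|lborel. Im (u x) * hermite_fun n x) = 0" for n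
      using integral_Im[OF prod[of n]] by (simp add: z)
  qed simp
  ultimately show ?thesis by eventually_elim (simp add: complex_eq_iff)
qed

text \<open>Riesz-Fischer builds a function \<open>v\<close> with the coefficients of
  \<open>u\<close>; the difference is orthogonal to every \<open>psi n\<close> and vanishes by
  completeness.\<close>

lemma hermite_expands:
  assumes u: "u \<in> sqint lborel"
  shows "herm.expands u (\<lambda>n. ip lborel u (psi n))"
proof -
  obtain v where v: "herm.expands v (\<lambda>n. ip lborel u (psi n))"
    using herm.Riesz_Fischer[OF herm.Bessel[OF u]] by metis
  have vs: "v \<in> sqint lborel" using v by (simp add: herm.expands_def)
  have "AE x in lborel. u x - v x = 0"
    by (rule hermite_complete) (simp_all add: sqint_diff u vs ip_diff_left herm.expands_coeff[OF v])
  then have eq: "AE x in lborel. v x = u x" by eventually_elim simp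
  have [measurable]: "u \<in> borel_measurable borel" "v \<in> borel_measurable borel"
      "herm.psum a N \<in> borel_measurable borel" for a N
    using u vs herm.psum_sqint[of a N] by (auto simp: sqint_def)
  have "nsq lborel (\<lambda>x. v x - herm.psum a N x) = nsq lborel (\<lambda>x. u x - herm.psum a N x)" for a N
    unfolding nsq_def by (rule integral_cong_AE) (use eq in auto)
  with v u show ?thesis by (simp add: herm.expands_def)
qed

section \<open>Radial and rotated integrals over the plane\<close>

text \<open>The area of the disc of radius \<open>sqrt a\<close> is linear in \<open>a\<close>;
  hence the squared modulus, unlike the modulus, has constant density on the half line.\<close>

lemma distr_cmod_power2:
  "distr lborel borel (\<lambda>z::complex. (cmod z)\<^sup>2) =
    density lborel (\<lambda>s. ennreal pi * indicator {0..} s)" (is "?M = ?N")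
proof (rule measure_eqI_generator_eq[where \<Omega> = UNIV and E = "range atMost" and A = "\<lambda>n. {..real n}"])
  have M: "emeasure ?M {..a} = (if 0 \<le> a then ennreal (pi * a) else 0)" for a :: real
  proof -
    have "emeasure ?M {..a} = emeasure lborel {z::complex. (cmod z)\<^sup>2 \<le> a}"
      by (subst emeasure_distr) (auto simp: vimage_def)
    also have "{z::complex. (cmod z)\<^sup>2 \<le> a} = (if 0 \<le> a then cball 0 (sqrt a) else {})"
      by (auto simp: real_le_rsqrt not_le intro: order_less_le_trans)
        (metis abs_le_square_iff abs_norm_cancel real_sqrt_abs real_sqrt_le_iff real_sqrt_pow2)
    also have "emeasure lborel \<dots> = (if 0 \<le> a then ennreal (pi * a) else 0)"
      by (simp add: emeasure_cball unit_ball_vol_2)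
    finally show ?thesis .
  qed
  show "emeasure ?M X = emeasure ?N X" if "X \<in> range atMost" for X
  proof -
    from that obtain a where X: "X = {..a}" by auto
    have "emeasure ?N {..a} = (\<integral>\<^sup>+s. ennreal pi * indicator {0..a} s \<partial>lborel)"
      by (subst emeasure_density) (auto intro!: nn_integral_cong split: split_indicator)
    also have "\<dots> = (if 0 \<le> a then ennreal (pi * a) else 0)"
      by (simp add: nn_integral_cmult ennreal_mult)
    finally show ?thesis by (simp add: X M)
  qed
  show "emeasure ?M {..real n} \<noteq> \<infinity>" for n :: nat by (simp add: M)
  show "(\<Union>n. {..real n}) = UNIV" by (auto intro: real_arch_simple)
qed (auto simp: Int_stable_def borel_eq_atMost)

text \<open>The second half of the radial substitution: with \<open>s\<close> the squared modulus,
  \<open>t = s powr (1 / q)\<close> has derivative \<open>s powr (1 / q - 1) / q\<close>. For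
  \<open>q > 1\<close> this is unbounded near 0 but still integrable, its exponent being above
  -1.\<close>

lemma distr_powr:
  fixes q :: real
  assumes q: "q > 0"
  shows "distr (density lborel (\<lambda>s. ennreal (indicator {0..} s * s powr (1 / q - 1) / q))) borel
      (\<lambda>s. s powr (1 / q)) = density lborel (indicator {0..})" (is "?M = ?N")
proof (rule measure_eqI_generator_eq[where \<Omega> = UNIV and E = "range atMost" and A = "\<lambda>n. {..real n}"])
  have M: "emeasure ?M {..a} = (if 0 \<le> a then ennreal a else 0)" for a :: real
  proof -
    have "emeasure ?M {..a} = (\<integral>\<^sup>+s. ennreal (indicator {0..} s * s powr (1 / q - 1) / q) *
        indicator {s. s powr (1 / q) \<le> a} s \<partial>lborel)"
      by (subst emeasure_distr) (auto simp: emeasure_density vimage_def)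
    also have "\<dots> = (\<integral>\<^sup>+s. ennreal (s powr (1 / q - 1) / q) *
        indicator (if 0 \<le> a then {0..a powr q} else {}) s \<partial>lborel)"
    proof (intro nn_integral_cong)
      fix s :: real
      have "s powr (1 / q) \<le> a \<longleftrightarrow> 0 \<le> a \<and> s \<le> a powr q" if "0 \<le> s"
      proof
        assume s: "s powr (1 / q) \<le> a"
        then have a: "0 \<le> a" using powr_ge_zero order_trans by blast
        have "s = (s powr (1 / q)) powr q" using that q by (simp add: powr_powr)
        also have "\<dots> \<le> a powr q" using s q by (intro powr_mono2) auto
        finally show "0 \<le> a \<and> s \<le> a powr q" using a by simp
      next
        assume s: "0 \<le> a \<and> s \<le> a powr q"
        then have "s powr (1 / q) \<le> (a powr q) powr (1 / q)"
          using that q by (intro powr_mono2) auto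
        then show "s powr (1 / q) \<le> a" using s q by (simp add: powr_powr)
      qed
      then show "ennreal (indicator {0..} s * s powr (1 / q - 1) / q) * indicator {s. s powr (1 / q) \<le> a} s =
          ennreal (s powr (1 / q - 1) / q) * indicator (if 0 \<le> a then {0..a powr q} else {}) s"
        by (auto split: split_indicator)
    qed
    also have "\<dots> = (if 0 \<le> a then ennreal a else 0)"
    proof (cases "0 \<le> a")
      case True
      have "((\<lambda>s. s powr (1 / q - 1) / q) has_integral
          ((a powr q) powr (1 / q - 1 + 1) / (1 / q - 1 + 1)) / q) {0..a powr q}"
        using q by (intro has_integral_divide has_integral_powr_from_0) auto
      then have "((\<lambda>s. s powr (1 / q - 1) / q) has_integral a) {0..a powr q}"
        using q True by (simp add: powr_powr)
      from nn_integral_has_integral_lebesgue'[OF _ this] show ?thesis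
        using True q by simp
    qed simp
    finally show ?thesis .
  qed
  show "emeasure ?M X = emeasure ?N X" if "X \<in> range atMost" for X
  proof -
    from that obtain a where X: "X = {..a}" by auto
    have "indicator {0..} s * indicator {..a} s = (indicator {0..a} s :: ennreal)" for s
      by (auto split: split_indicator)
    then have "emeasure ?N {..a} = emeasure lborel {0..a}"
      by (simp add: emeasure_density)
    also have "\<dots> = (if 0 \<le> a then ennreal a else 0)" by simp
    finally show ?thesis by (simp add: X M)
  qed
  show "emeasure ?M {..real n} \<noteq> \<infinity>" for n :: nat by (simp add: M)
  show "(\<Union>n. {..real n}) = UNIV" by (auto intro: real_arch_simple)
qed (auto simp: Int_stable_def borel_eq_atMost)

text \<open>The factor \<open>cmod z powr (2 / q - 2)\<close> is exactly the Jacobian of the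
  substitution, and \<open>q * pi\<close> is what the inner product divides by. Working with
  nonnegative integrals postpones all questions of integrability.\<close>

lemma nn_integral_radial:
  fixes q :: real and g :: "real \<Rightarrow> ennreal"
  assumes q: "q > 0" and [measurable]: "g \<in> borel_measurable borel"
  shows "(\<integral>\<^sup>+(z::complex). ennreal (cmod z powr (2 / q - 2)) * g (cmod z powr (2 / q)) \<partial>lborel) =
    ennreal (q * pi) * (\<integral>\<^sup>+t. indicator {0..} t * g t \<partial>lborel)"
proof -
  define h where "h s = ennreal (s powr (1 / q - 1)) * g (s powr (1 / q))" for s :: real
  have [measurable]: "h \<in> borel_measurable borel"
    unfolding h_def[abs_def] by measurable
  have pw: "((cmod z)\<^sup>2) powr a = cmod z powr (2 * a)" for z a
    by (cases "z = 0") (simp_all add: powr_powr[symmetric] powr_numeral)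
  have "(\<integral>\<^sup>+(z::complex). ennreal (cmod z powr (2 / q - 2)) * g (cmod z powr (2 / q)) \<partial>lborel) =
      (\<integral>\<^sup>+(z::complex). h ((cmod z)\<^sup>2) \<partial>lborel)"
    by (simp add: h_def pw right_diff_distrib)
  also have "\<dots> = (\<integral>\<^sup>+s. h s \<partial>distr lborel borel (\<lambda>z::complex. (cmod z)\<^sup>2))"
    by (rule nn_integral_distr[symmetric]) measurable
  also have "\<dots> = (\<integral>\<^sup>+s. ennreal pi * indicator {0..} s * h s \<partial>lborel)"
    unfolding distr_cmod_power2 by (rule nn_integral_density) measurable
  also have "\<dots> = (\<integral>\<^sup>+s. ennreal (q * pi) * (ennreal (indicator {0..} s * s powr (1 / q - 1) / q) * g (s powr (1 / q))) \<partial>lborel)"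
  proof (intro nn_integral_cong)
    fix s :: real
    have "ennreal pi * ennreal (s powr (1 / q - 1)) = ennreal (q * pi) * ennreal (s powr (1 / q - 1) / q)"
      using q by (simp add: ennreal_mult[symmetric])
    then show "ennreal pi * indicator {0..} s * h s =
        ennreal (q * pi) * (ennreal (indicator {0..} s * s powr (1 / q - 1) / q) * g (s powr (1 / q)))"
      by (cases "0 \<le> s") (simp_all add: h_def mult.assoc[symmetric])
  qed
  also have "\<dots> = ennreal (q * pi) * (\<integral>\<^sup>+s. ennreal (indicator {0..} s * s powr (1 / q - 1) / q) * g (s powr (1 / q)) \<partial>lborel)"
    by (rule nn_integral_cmult) measurable
  also have "(\<integral>\<^sup>+s. ennreal (indicator {0..} s * s powr (1 / q - 1) / q) * g (s powr (1 / q)) \<partial>lborel) =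
      (\<integral>\<^sup>+s. g (s powr (1 / q)) \<partial>density lborel (\<lambda>s. ennreal (indicator {0..} s * s powr (1 / q - 1) / q)))"
    by (rule nn_integral_density[symmetric]) measurable
  also have "\<dots> = (\<integral>\<^sup>+t. g t \<partial>distr (density lborel (\<lambda>s. ennreal (indicator {0..} s * s powr (1 / q - 1) / q))) borel
      (\<lambda>s. s powr (1 / q)))"
    by (rule nn_integral_distr[symmetric]) measurable
  also have "\<dots> = (\<integral>\<^sup>+t. indicator {0..} t * g t \<partial>lborel)"
    unfolding distr_powr[OF q] by (rule nn_integral_density) measurable
  finally show ?thesis .
qed

section \<open>Rotation invariance of planar Lebesgue measure\<close>

lemma lborel_complex_eq: "(lborel :: complex measure) = distr (lborel \<Otimes>\<^sub>M lborel) borel (\<lambda>(x, y). Complex x y)"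
proof (rule lborel_eqI)
  have [measurable]: "(\<lambda>(x, y). Complex x y) \<in> borel_measurable (lborel \<Otimes>\<^sub>M lborel)"
    unfolding complex_eq[symmetric] Complex_eq case_prod_beta by measurable
  fix l u :: complex
  assume lu: "\<And>b. b \<in> Basis \<Longrightarrow> l \<bullet> b \<le> u \<bullet> b"
  then have le: "Re l \<le> Re u" "Im l \<le> Im u"
    using lu[of 1] lu[of \<i>] by (auto simp: Basis_complex_def)
  have "emeasure (distr (lborel \<Otimes>\<^sub>M lborel) borel (\<lambda>(x, y). Complex x y)) (box l u) =
      emeasure (lborel \<Otimes>\<^sub>M lborel) ({Re l<..<Re u} \<times> {Im l<..<Im u})"
    by (subst emeasure_distr)
      (auto intro!: arg_cong[where f = "emeasure _"] simp: box_def Basis_complex_def space_pair_measure)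
  also have "\<dots> = ennreal (Re u - Re l) * ennreal (Im u - Im l)"
    using le by (simp add: lborel.emeasure_pair_measure_Times)
  also have "\<dots> = ennreal (\<Prod>b\<in>Basis. (u - l) \<bullet> b)"
    using le by (simp add: Basis_complex_def ennreal_mult[symmetric])
  finally show "emeasure (distr (lborel \<Otimes>\<^sub>M lborel) borel (\<lambda>(x, y). Complex x y)) (box l u) =
      ennreal (\<Prod>b\<in>Basis. (u - l) \<bullet> b)" .
qed simp

lemma Complex_measurable [measurable (raw)]:
  "f \<in> borel_measurable M \<Longrightarrow> g \<in> borel_measurable M \<Longrightarrow> (\<lambda>x. Complex (f x) (g x)) \<in> borel_measurable M"
  by (simp add: borel_measurable_complex_iff)

lemma nn_integral_complex:
  assumes [measurable]: "f \<in> borel_measurable borel"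
  shows "(\<integral>\<^sup>+z. f z \<partial>lborel) = (\<integral>\<^sup>+x. \<integral>\<^sup>+y. f (Complex x y) \<partial>lborel \<partial>lborel)"
    and "(\<integral>\<^sup>+z. f z \<partial>lborel) = (\<integral>\<^sup>+y. \<integral>\<^sup>+x. f (Complex x y) \<partial>lborel \<partial>lborel)"
proof -
  have "(\<integral>\<^sup>+z. f z \<partial>lborel) = (\<integral>\<^sup>+p. f (Complex (fst p) (snd p)) \<partial>(lborel \<Otimes>\<^sub>M lborel))"
    unfolding lborel_complex_eq by (subst nn_integral_distr) (auto simp: case_prod_beta)
  moreover have "\<dots> = (\<integral>\<^sup>+x. \<integral>\<^sup>+y. f (Complex x y) \<partial>lborel \<partial>lborel)"
    by (subst lborel.nn_integral_fst[symmetric]) auto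
  moreover have "(\<integral>\<^sup>+p. f (Complex (fst p) (snd p)) \<partial>(lborel \<Otimes>\<^sub>M lborel)) =
      (\<integral>\<^sup>+y. \<integral>\<^sup>+x. f (Complex x y) \<partial>lborel \<partial>lborel)"
    by (subst lborel_pair.nn_integral_snd[symmetric]) (auto simp: case_prod_beta)
  ultimately show "(\<integral>\<^sup>+z. f z \<partial>lborel) = (\<integral>\<^sup>+x. \<integral>\<^sup>+y. f (Complex x y) \<partial>lborel \<partial>lborel)"
    and "(\<integral>\<^sup>+z. f z \<partial>lborel) = (\<integral>\<^sup>+y. \<integral>\<^sup>+x. f (Complex x y) \<partial>lborel \<partial>lborel)"
    by simp_all
qed

lemma nn_integral_translate:
  fixes f :: "real \<Rightarrow> ennreal"
  assumes [measurable]: "f \<in> borel_measurable borel"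
  shows "(\<integral>\<^sup>+x. f (x + c) \<partial>lborel) = (\<integral>\<^sup>+x. f x \<partial>lborel)"
  using nn_integral_real_affine[of f 1 c] by (simp add: add.commute)

text \<open>On each line parallel to the fixed axis a shear is a translation, so iterated
  integration in the matching order reduces it to the invariance of linear Lebesgue measure.\<close>

lemma nn_integral_shear:
  fixes a :: real
  assumes [measurable]: "f \<in> borel_measurable borel"
  shows "(\<integral>\<^sup>+z. f (Complex (Re z + a * Im z) (Im z)) \<partial>lborel) = (\<integral>\<^sup>+z. f z \<partial>lborel)"
    and "(\<integral>\<^sup>+z. f (Complex (Re z) (Im z + a * Re z)) \<partial>lborel) = (\<integral>\<^sup>+z. f z \<partial>lborel)"
proof -
  have "(\<integral>\<^sup>+z. f (Complex (Re z + a * Im z) (Im z)) \<partial>lborel) =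
      (\<integral>\<^sup>+y. \<integral>\<^sup>+x. f (Complex (x + a * y) y) \<partial>lborel \<partial>lborel)"
    by (subst nn_integral_complex(2)) auto
  also have "\<dots> = (\<integral>\<^sup>+y. \<integral>\<^sup>+x. f (Complex x y) \<partial>lborel \<partial>lborel)"
    by (subst nn_integral_translate) auto
  finally show "(\<integral>\<^sup>+z. f (Complex (Re z + a * Im z) (Im z)) \<partial>lborel) = (\<integral>\<^sup>+z. f z \<partial>lborel)"
    by (simp add: nn_integral_complex(2))
  have "(\<integral>\<^sup>+z. f (Complex (Re z) (Im z + a * Re z)) \<partial>lborel) =
      (\<integral>\<^sup>+x. \<integral>\<^sup>+y. f (Complex x (y + a * x)) \<partial>lborel \<partial>lborel)"
    by (subst nn_integral_complex(1)) auto
  also have "\<dots> = (\<integral>\<^sup>+x. \<integral>\<^sup>+y. f (Complex x y) \<partial>lborel \<partial>lborel)"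
    by (subst nn_integral_translate) auto
  finally show "(\<integral>\<^sup>+z. f (Complex (Re z) (Im z + a * Re z)) \<partial>lborel) = (\<integral>\<^sup>+z. f z \<partial>lborel)"
    by (simp add: nn_integral_complex(1))
qed

text \<open>A rotation by an angle that is not a multiple of \<open>\<pi>\<close> is a product of three shears.\<close>

lemma nn_integral_rotate:
  assumes [measurable]: "f \<in> borel_measurable borel" and c: "cmod c = 1" "Im c \<noteq> 0"
  shows "(\<integral>\<^sup>+z. f (c * z) \<partial>lborel) = (\<integral>\<^sup>+z. f z \<partial>lborel)"
proof -
  define b where "b = Im c"
  \<comment> \<open>For \<open>c = cis t\<close> these are \<open>b = sin t\<close> and
    \<open>a = - tan (t / 2)\<close>; the division explains the condition
    \<open>Im c \<noteq> 0\<close>.\<close>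
  define a where "a = (Re c - 1) / b"
  define S where "S z = Complex (Re z + a * Im z) (Im z)" for z
  define T where "T z = Complex (Re z) (Im z + b * Re z)" for z
  have [measurable]: "S \<in> borel_measurable borel" "T \<in> borel_measurable borel"
    unfolding S_def[abs_def] T_def[abs_def] by measurable
  have ab: "a * b = Re c - 1" using c by (simp add: a_def b_def)
  have "(Re c)\<^sup>2 + b\<^sup>2 = 1" using c cmod_power2[of c] by (simp add: b_def)
  then have "(a * (2 + a * b)) * b = (- b) * b"
    unfolding mult.assoc mult.commute[of "2 + a * b" b] unfolding mult.assoc[symmetric] ab
    by (simp add: algebra_simps power2_eq_square)
  \<comment> \<open>Multiplied by \<open>b\<close>, this is
    \<open>(Re c - 1) * (Re c + 1) = - b\<^sup>2\<close>, which is
    \<open>cmod c = 1\<close>.\<close>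
  then have ab2: "a * (2 + a * b) = - b"
    using c by (metis b_def mult_right_cancel)
  have rot: "c * z = S (T (S z))" for z
  proof -
    have "Re (S (T (S z))) = Re z * (1 + a * b) + Im z * (a * (2 + a * b))"
      by (simp add: S_def T_def algebra_simps)
    moreover have "Im (S (T (S z))) = Im z * (1 + a * b) + b * Re z"
      by (simp add: S_def T_def algebra_simps)
    ultimately show ?thesis
      unfolding ab2 unfolding ab by (simp add: complex_eq_iff b_def mult.commute)
  qed
  have "(\<integral>\<^sup>+z. f (S (T (S z))) \<partial>lborel) = (\<integral>\<^sup>+z. f (S (T z)) \<partial>lborel)"
    using nn_integral_shear(1)[of "\<lambda>z. f (S (T z))" a] by (simp add: S_def[symmetric])
  also have "\<dots> = (\<integral>\<^sup>+z. f (S z) \<partial>lborel)"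
    using nn_integral_shear(2)[of "\<lambda>z. f (S z)" b] by (simp add: T_def[symmetric])
  also have "\<dots> = (\<integral>\<^sup>+z. f z \<partial>lborel)"
    using nn_integral_shear(1)[of f a] by (simp add: S_def[symmetric])
  finally show ?thesis by (simp add: rot)
qed

lemma distr_lborel_rotate:
  assumes "cmod c = 1" "Im c \<noteq> 0"
  shows "distr lborel borel ((*) c) = (lborel :: complex measure)"
proof (rule measure_eqI)
  fix A assume "A \<in> sets (distr lborel borel ((*) c))"
  then have [measurable]: "A \<in> sets borel" by simp
  have "emeasure (distr lborel borel ((*) c)) A = (\<integral>\<^sup>+z. indicator A z \<partial>distr lborel borel ((*) c))"
    by simp
  also have "\<dots> = (\<integral>\<^sup>+z. indicator A (c * z) \<partial>lborel)"
    by (rule nn_integral_distr) measurable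
  also have "\<dots> = emeasure lborel A"
    using nn_integral_rotate[of "indicator A" c] assms by simp
  finally show "emeasure (distr lborel borel ((*) c)) A = emeasure lborel A" .
qed simp

lemma integral_rotate:
  fixes f :: "complex \<Rightarrow> complex"
  assumes "f \<in> borel_measurable borel" "cmod c = 1" "Im c \<noteq> 0"
  shows "(LINT z|lborel. f (c * z)) = (LINT z|lborel. f z)"
  using integral_distr[of "(*) c" lborel borel f] assms by (simp add: distr_lborel_rotate)

text \<open>Rotating by \<open>c\<close> multiplies the integrand by
  \<open>c ^ m * cnj c ^ n\<close>, so the integral equals itself times a factor different from 1.
  The steps also hold for a divergent integral, whose value is 0 by convention.\<close>

lemma integral_radial_monomials_eq_0:
  fixes \<rho> :: "real \<Rightarrow> real"
  assumes "m \<noteq> n" and [measurable]: "\<rho> \<in> borel_measurable borel"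
  shows "(LINT z|lborel. z ^ m * cnj z ^ n * complex_of_real (\<rho> (cmod z))) = 0"
proof -
  define d where "d = real m - real n"
  \<comment> \<open>The angle is chosen so that the factor is \<open>cis (pi / 2)\<close> or its
    conjugate. Since \<open>\<bar>d\<bar> \<ge> 1\<close>, it lies strictly between 0 and
    \<open>pi\<close>, which gives the nonzero imaginary part required for the rotation.\<close>
  define c where "c = cis (pi / (2 * \<bar>d\<bar>))"
  have d: "\<bar>d\<bar> \<ge> 1" using assms(1) by (auto simp: d_def)
  have "c ^ m * cnj c ^ n = cis (real m * (pi / (2 * \<bar>d\<bar>)) + real n * (- (pi / (2 * \<bar>d\<bar>))))"
    unfolding c_def cis_cnj Complex.DeMoivre cis_mult ..
  also have "real m * (pi / (2 * \<bar>d\<bar>)) + real n * (- (pi / (2 * \<bar>d\<bar>))) = d / \<bar>d\<bar> * (pi / 2)"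
  proof -
    have "real m * t + real n * (- t) = d * t" for t
      by (simp add: d_def algebra_simps)
    from this[of "pi / (2 * \<bar>d\<bar>)"] show ?thesis by (simp add: mult_ac)
  qed
  also have "d / \<bar>d\<bar> = 1 \<or> d / \<bar>d\<bar> = -1" using d by (auto simp: abs_if)
  then have "cis (d / \<bar>d\<bar> * (pi / 2)) \<noteq> 1"
    by (elim disjE; simp only:; simp add: complex_eq_iff)
  finally have ne: "c ^ m * cnj c ^ n \<noteq> 1" .
  have "0 < pi / (2 * \<bar>d\<bar>)" "pi / (2 * \<bar>d\<bar>) < pi"
    using d by (auto simp: field_simps)
  then have "sin (pi / (2 * \<bar>d\<bar>)) > 0" by (rule sin_gt_zero)
  then have c: "cmod c = 1" "Im c \<noteq> 0" by (auto simp: c_def)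
  let ?f = "\<lambda>z. z ^ m * cnj z ^ n * complex_of_real (\<rho> (cmod z))"
  have "(LINT z|lborel. ?f z) = (LINT z|lborel. ?f (c * z))"
    by (rule integral_rotate[symmetric, OF _ c]) measurable
  also have "\<dots> = (LINT z|lborel. (c ^ m * cnj c ^ n) * ?f z)"
    by (intro Bochner_Integration.integral_cong)
      (simp_all add: power_mult_distrib norm_mult c mult_ac)
  also have "\<dots> = (c ^ m * cnj c ^ n) * (LINT z|lborel. ?f z)"
    by (rule Bochner_Integration.integral_mult_right_zero)
  finally show ?thesis using ne by (simp only: mult_cancel_right1) blast
qed

section \<open>The Mittag-Leffler Fock space\<close>

text \<open>The Gamma integral is restricted to the interval from \<open>T\<close> to
  \<open>T + 1\<close>. As \<open>T\<close> is free, the Gamma function outgrows every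
  exponential.\<close>

lemma Gamma_ge_powr:
  assumes s: "s \<ge> (0::real)" and T: "T > 0"
  shows "Gamma (s + 1) \<ge> T powr s * exp (- (T + 1))"
proof -
  have "ennreal (T powr s * exp (- (T + 1))) =
      (\<integral>\<^sup>+t. ennreal (T powr s * exp (- (T + 1))) * indicator {T..T + 1} t \<partial>lborel)"
    by (simp add: nn_integral_cmult)
  also have "\<dots> \<le> (\<integral>\<^sup>+t. ennreal (indicator {0..} t * t powr (s + 1 - 1) / exp t) \<partial>lborel)"
  proof (intro nn_integral_mono)
    fix t :: real
    have "T powr s * exp (- (T + 1)) \<le> t powr s * exp (- t)" if "T \<le> t" "t \<le> T + 1"
      using that s T by (intro mult_mono powr_mono2) auto
    then show "ennreal (T powr s * exp (- (T + 1))) * indicator {T..T + 1} t \<le>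
        ennreal (indicator {0..} t * t powr (s + 1 - 1) / exp t)"
      using T by (auto simp: exp_minus divide_inverse split: split_indicator intro!: ennreal_leI)
  qed
  also have "\<dots> = ennreal (Gamma (s + 1))"
    using Gamma_conv_nn_integral_real[of "s + 1"] s by simp
  finally show ?thesis
    using Gamma_real_pos[of "s + 1"] s by (simp add: ennreal_le_iff)
qed

lemma summable_mlf_kernel:
  assumes q: "q > (0::real)"
  shows "summable (\<lambda>n. K ^ n / sqrt (Gamma (q * real n + 1)))"
proof -
  \<comment> \<open>This makes \<open>T powr (q * real n)\<close> the square of
    \<open>(2 * \<bar>K\<bar> + 1) ^ n\<close>, so after the square root the denominator beats
    \<open>\<bar>K\<bar> ^ n\<close> by \<open>2 ^ n\<close>, up to the constant \<open>C\<close>,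
    the square root of \<open>exp (T + 1)\<close>. The summand 1 keeps the base positive when
    \<open>K = 0\<close>.\<close>
  define T where "T = (2 * \<bar>K\<bar> + 1) powr (2 / q)"
  have T: "T > 0" by (simp add: T_def)
  define C where "C = exp ((T + 1) / 2)"
  have C: "C > 0" by (simp add: C_def)
  show ?thesis
  proof (rule summable_comparison_test')
    show "summable (\<lambda>n. C * (1 / 2) ^ n)"
      by (intro summable_mult summable_geometric) simp
    fix n :: nat
    have G: "Gamma (q * real n + 1) > 0" using q by (intro Gamma_real_pos) (simp add: add_nonneg_pos)
    have "T powr (q * real n) = ((2 * \<bar>K\<bar> + 1) ^ n)\<^sup>2"
    proof -
      have "T powr (q * real n) = (2 * \<bar>K\<bar> + 1) powr real (2 * n)"
        using q by (simp add: T_def powr_powr mult.commute)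
      also have "\<dots> = (2 * \<bar>K\<bar> + 1) ^ (2 * n)" by (rule powr_realpow) simp
      finally show ?thesis by (simp add: power_even_eq)
    qed
    moreover have "exp (- (T + 1)) = (1 / C)\<^sup>2"
    proof -
      have "C\<^sup>2 = exp (2 * ((T + 1) / 2))" unfolding C_def by (rule exp_double[symmetric])
      then have "C\<^sup>2 = exp (T + 1)" by simp
      then show ?thesis by (simp only: power_divide exp_minus inverse_eq_divide power_one)
    qed
    moreover have "T powr (q * real n) * exp (- (T + 1)) \<le> Gamma (q * real n + 1)"
      by (rule Gamma_ge_powr) (use q T in auto)
    ultimately have "((2 * \<bar>K\<bar> + 1) ^ n * (1 / C))\<^sup>2 \<le> Gamma (q * real n + 1)"
      by (simp only: power_mult_distrib)
    then have le: "(2 * \<bar>K\<bar> + 1) ^ n * (1 / C) \<le> sqrt (Gamma (q * real n + 1))"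
      by (rule real_le_rsqrt)
    have "\<bar>K\<bar> ^ n * 2 ^ n \<le> (2 * \<bar>K\<bar> + 1) ^ n"
      unfolding power_mult_distrib[symmetric] by (intro power_mono) auto
    also have "\<dots> \<le> C * sqrt (Gamma (q * real n + 1))"
      using le C by (simp add: divide_le_eq mult.commute)
    finally have "\<bar>K\<bar> ^ n * 2 ^ n / sqrt (Gamma (q * real n + 1)) \<le> C"
      using G by (simp add: divide_le_eq)
    then have "\<bar>K\<bar> ^ n * 2 ^ n / sqrt (Gamma (q * real n + 1)) * (1 / 2) ^ n \<le> C * (1 / 2) ^ n"
      by (intro mult_right_mono) auto
    moreover have "\<bar>K\<bar> ^ n * 2 ^ n / sqrt (Gamma (q * real n + 1)) * (1 / 2) ^ n =
        norm (K ^ n / sqrt (Gamma (q * real n + 1)))"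
      using G by (simp add: power_one_over power_abs)
    ultimately show "norm (K ^ n / sqrt (Gamma (q * real n + 1))) \<le> C * (1 / 2) ^ n"
      by (simp only:)
  qed
qed

section \<open>The weighted probability measure and its moments\<close>

locale mlf_order =
  fixes q :: real
  assumes q_pos: "q > 0"
begin

definition \<gamma> :: "nat \<Rightarrow> real" where
  "\<gamma> n = Gamma (q * real n + 1)"

text \<open>With the constant \<open>1 / (q * pi)\<close> absorbed into the measure,
  \<open>MLF_inner\<close> becomes an instance of \<open>ip\<close> and the total mass becomes
  1.\<close>

definition mlf :: "complex measure" where
  "mlf = density lborel (\<lambda>z. ennreal (MLF_weight q z / (q * pi)))"

definition mon :: "nat \<Rightarrow> complex \<Rightarrow> complex" where
  "mon n z = z ^ n / complex_of_real (sqrt (\<gamma> n))"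

lemma \<gamma>_pos: "\<gamma> n > 0"
  unfolding \<gamma>_def using q_pos by (intro Gamma_real_pos) (simp add: add_nonneg_pos)

lemma weight_nonneg: "MLF_weight q z / (q * pi) \<ge> 0"
  using q_pos by (simp add: MLF_weight_def)

lemma weight_measurable [measurable]: "MLF_weight q \<in> borel_measurable borel"
  unfolding MLF_weight_def[abs_def] by measurable

lemma sets_mlf [simp, measurable_cong]: "sets mlf = sets borel"
  by (simp add: mlf_def)

lemma space_mlf [simp]: "space mlf = UNIV"
  by (simp add: mlf_def)

lemma integrable_mlf:
  fixes f :: "complex \<Rightarrow> 'b::{banach, second_countable_topology}"
  assumes "f \<in> borel_measurable borel"
  shows "integrable mlf f \<longleftrightarrow> integrable lborel (\<lambda>z. MLF_weight q z *\<^sub>R f z)"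
proof -
  have "integrable mlf f \<longleftrightarrow> integrable lborel (\<lambda>z. (MLF_weight q z / (q * pi)) *\<^sub>R f z)"
    unfolding mlf_def using assms weight_nonneg by (intro integrable_density) auto
  also have "(\<lambda>z. (MLF_weight q z / (q * pi)) *\<^sub>R f z) = (\<lambda>z. (1 / (q * pi)) *\<^sub>R MLF_weight q z *\<^sub>R f z)"
    by (simp add: fun_eq_iff)
  also have "integrable lborel \<dots> \<longleftrightarrow> integrable lborel (\<lambda>z. MLF_weight q z *\<^sub>R f z)"
  proof
    assume "integrable lborel (\<lambda>z. (1 / (q * pi)) *\<^sub>R MLF_weight q z *\<^sub>R f z)"
    then have "integrable lborel (\<lambda>z. (q * pi) *\<^sub>R (1 / (q * pi)) *\<^sub>R MLF_weight q z *\<^sub>R f z)"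
      by (rule integrable_scaleR_right)
    then show "integrable lborel (\<lambda>z. MLF_weight q z *\<^sub>R f z)"
      using q_pos by simp
  qed (rule integrable_scaleR_right)
  finally show ?thesis .
qed

lemma integral_mlf:
  fixes f :: "complex \<Rightarrow> complex"
  assumes "f \<in> borel_measurable borel"
  shows "(LINT z|mlf. f z) =
    complex_of_real (1 / (q * pi)) * (LINT z|lborel. f z * complex_of_real (MLF_weight q z))"
proof -
  have "(LINT z|mlf. f z) = (LINT z|lborel. (MLF_weight q z / (q * pi)) *\<^sub>R f z)"
    unfolding mlf_def using assms weight_nonneg by (intro integral_density) auto
  also have "\<dots> = (LINT z|lborel. complex_of_real (1 / (q * pi)) * (f z * complex_of_real (MLF_weight q z)))"
    by (intro Bochner_Integration.integral_cong) (simp_all add: scaleR_conv_of_real)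
  finally show ?thesis by simp
qed

text \<open>In probabilistic terms, \<open>cmod z powr (2 / q)\<close> has the standard exponential
  distribution under \<open>mlf\<close>.\<close>

lemma nn_integral_mlf_radial:
  assumes [measurable]: "g \<in> borel_measurable borel"
  shows "(\<integral>\<^sup>+z. g (cmod z powr (2 / q)) \<partial>mlf) = (\<integral>\<^sup>+t. indicator {0..} t * (ennreal (exp (- t)) * g t) \<partial>lborel)"
proof -
  have "(\<integral>\<^sup>+z. g (cmod z powr (2 / q)) \<partial>mlf) =
      (\<integral>\<^sup>+z. ennreal (MLF_weight q z / (q * pi)) * g (cmod z powr (2 / q)) \<partial>lborel)"
    unfolding mlf_def by (rule nn_integral_density) measurable
  also have "\<dots> = (\<integral>\<^sup>+z. ennreal (cmod z powr (2 / q - 2)) * (ennreal (1 / (q * pi)) *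
      (ennreal (exp (- (cmod z powr (2 / q)))) * g (cmod z powr (2 / q)))) \<partial>lborel)"
  proof (intro nn_integral_cong)
    fix z
    have "ennreal (MLF_weight q z / (q * pi)) = ennreal (cmod z powr (2 / q - 2)) *
        (ennreal (1 / (q * pi)) * ennreal (exp (- (cmod z powr (2 / q)))))"
      using q_pos by (simp add: MLF_weight_def ennreal_mult[symmetric])
    then show "ennreal (MLF_weight q z / (q * pi)) * g (cmod z powr (2 / q)) =
      ennreal (cmod z powr (2 / q - 2)) * (ennreal (1 / (q * pi)) *
      (ennreal (exp (- (cmod z powr (2 / q)))) * g (cmod z powr (2 / q))))"
      by (simp only: mult.assoc)
  qed
  also have "\<dots> = ennreal (q * pi) * (\<integral>\<^sup>+t. indicator {0..} t * (ennreal (1 / (q * pi)) * (ennreal (exp (- t)) * g t)) \<partial>lborel)"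
    by (rule nn_integral_radial[OF q_pos]) measurable
  also have "\<dots> = (\<integral>\<^sup>+t. ennreal (q * pi) * (indicator {0..} t * (ennreal (1 / (q * pi)) * (ennreal (exp (- t)) * g t))) \<partial>lborel)"
    by (rule nn_integral_cmult[symmetric]) measurable
  also have "\<dots> = (\<integral>\<^sup>+t. indicator {0..} t * (ennreal (exp (- t)) * g t) \<partial>lborel)"
  proof (intro nn_integral_cong)
    fix t :: real
    have "ennreal (q * pi) * ennreal (1 / (q * pi)) = 1"
      using q_pos by (simp add: ennreal_mult[symmetric])
    then show "ennreal (q * pi) * (indicator {0..} t * (ennreal (1 / (q * pi)) * (ennreal (exp (- t)) * g t))) =
        indicator {0..} t * (ennreal (exp (- t)) * g t)"
      by (cases "0 \<le> t") (simp_all add: mult.assoc[symmetric])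
  qed
  finally show ?thesis .
qed

lemma measurable_mlf [simp]: "borel_measurable mlf = borel_measurable borel"
  by (rule measurable_cong_sets) simp_all

lemma cball_borel [measurable]: "cball (0::complex) R \<in> sets borel"
  by simp

text \<open>Real and natural powers disagree at the origin, where \<open>0 powr 0 = 0\<close> but
  \<open>0 ^ 0 = 1\<close>; the moment computation for \<open>n = 0\<close> therefore has to discard
  this point.\<close>

lemma AE_mlf_nonzero: "AE z in mlf. z \<noteq> 0"
proof -
  have "AE z in lborel. z \<noteq> (0::complex)" by (rule AE_lborel_singleton)
  then show ?thesis unfolding mlf_def by (subst AE_density) auto
qed

lemma nn_moment: "(\<integral>\<^sup>+z. ennreal (cmod z ^ (2 * n)) \<partial>mlf) = ennreal (\<gamma> n)"
proof -
  have "(\<integral>\<^sup>+z. ennreal (cmod z ^ (2 * n)) \<partial>mlf) = (\<integral>\<^sup>+z. ennreal ((cmod z powr (2 / q)) powr (q * real n)) \<partial>mlf)"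
  proof (rule nn_integral_cong_AE, use AE_mlf_nonzero in eventually_elim)
    case (elim z)
    then have "(cmod z powr (2 / q)) powr (q * real n) = cmod z powr (real (2 * n))"
      using q_pos by (simp add: powr_powr)
    then show ?case using elim by (subst (asm) powr_realpow) auto
  qed
  also have "\<dots> = (\<integral>\<^sup>+t. indicator {0..} t * (ennreal (exp (- t)) * ennreal (t powr (q * real n))) \<partial>lborel)"
    by (rule nn_integral_mlf_radial) measurable
  also have "\<dots> = (\<integral>\<^sup>+t. ennreal (indicator {0..} t * t powr (q * real n + 1 - 1) / exp t) \<partial>lborel)"
    by (intro nn_integral_cong)
      (simp add: ennreal_mult[symmetric] exp_minus divide_inverse mult.commute split: split_indicator)
  also have "\<dots> = ennreal (\<gamma> n)"
    unfolding \<gamma>_def using q_pos by (subst Gamma_conv_nn_integral_real) (simp_all add: add_nonneg_pos)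
  finally show ?thesis .
qed

sublocale mlf: prob_space mlf
proof (rule prob_spaceI)
  show "emeasure mlf (space mlf) = 1"
    using nn_moment[of 0] by (simp add: \<gamma>_def)
qed

lemma moment_integrable: "integrable mlf (\<lambda>z. cmod z ^ (2 * n))"
  by (rule integrableI_bounded) (simp_all add: nn_moment)

lemma moment: "(LINT z|mlf. cmod z ^ (2 * n)) = \<gamma> n"
  by (rule integral_eq_nn_integral[THEN trans]) (simp_all add: nn_moment \<gamma>_pos less_imp_le)

section \<open>Moments over discs and orthonormality of the monomials\<close>

definition disc_moment :: "nat \<Rightarrow> real \<Rightarrow> real" where
  "disc_moment n R = (LINT z|mlf. indicator (cball 0 R) z * cmod z ^ (2 * n))"

lemma disc_moment_integrable: "integrable mlf (\<lambda>z. indicator (cball 0 R) z * cmod z ^ (2 * n))"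
  by (rule Bochner_Integration.integrable_bound[OF moment_integrable[of n]])
    (auto split: split_indicator)

lemma disc_moment_bounds: "0 \<le> disc_moment n R" "disc_moment n R \<le> \<gamma> n"
proof -
  show "0 \<le> disc_moment n R"
    unfolding disc_moment_def by (intro Bochner_Integration.integral_nonneg) simp
  show "disc_moment n R \<le> \<gamma> n"
    unfolding disc_moment_def moment[symmetric]
    by (intro integral_mono disc_moment_integrable moment_integrable) (simp split: split_indicator)
qed

lemma indicator_cball_tendsto:
  "((\<lambda>R. indicator (cball 0 R) z :: real) \<longlongrightarrow> 1) at_top" for z :: complex
proof (rule tendsto_eventually)
  show "eventually (\<lambda>R. indicator (cball 0 R) z = (1::real)) at_top"
    using eventually_ge_at_top[of "cmod z"] by eventually_elim simp
qed

lemma disc_moment_tendsto: "(disc_moment n \<longlongrightarrow> \<gamma> n) at_top"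
proof -
  have "((\<lambda>R. LINT z|mlf. indicator (cball 0 R) z * cmod z ^ (2 * n)) \<longlongrightarrow>
      (LINT z|mlf. cmod z ^ (2 * n))) at_top"
  proof (rule integral_dominated_convergence_at_top[OF _ _ moment_integrable[of n]])
    show "\<forall>\<^sub>F R in at_top. AE z in mlf. norm (indicator (cball 0 R) z * cmod z ^ (2 * n)) \<le> cmod z ^ (2 * n)"
      by (intro always_eventually allI AE_I2) (simp split: split_indicator)
    show "AE z in mlf. ((\<lambda>R. indicator (cball 0 R) z * cmod z ^ (2 * n)) \<longlongrightarrow> cmod z ^ (2 * n)) at_top"
      using tendsto_mult_right[OF indicator_cball_tendsto] by (intro AE_I2) force
  qed simp_all
  then show ?thesis by (simp add: moment disc_moment_def[abs_def])
qed

lemma disc_monomials: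
  "(LINT z|mlf. complex_of_real (indicator (cball 0 R) z) * (z ^ m * cnj z ^ n)) =
    (if m = n then complex_of_real (disc_moment n R) else 0)"
proof (cases "m = n")
  case True
  have "z ^ n * cnj z ^ n = complex_of_real (cmod z ^ (2 * n))" for z
    by (simp add: power_mult_distrib[symmetric] complex_norm_square[symmetric] power_mult)
  then have "(LINT z|mlf. complex_of_real (indicator (cball 0 R) z) * (z ^ n * cnj z ^ n)) =
      (LINT z|mlf. complex_of_real (indicator (cball 0 R) z * cmod z ^ (2 * n)))"
    by (simp only: of_real_mult)
  then show ?thesis
    using True by (simp only: disc_moment_def integral_complex_of_real refl if_True)
next
  case False
  define \<rho> where "\<rho> r = indicator {..R} r * (r powr (2 / q - 2) * exp (- (r powr (2 / q))))" for r
  have [measurable]: "\<rho> \<in> borel_measurable borel"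
    unfolding \<rho>_def[abs_def] by measurable
  have "(LINT z|mlf. complex_of_real (indicator (cball 0 R) z) * (z ^ m * cnj z ^ n)) =
      complex_of_real (1 / (q * pi)) *
        (LINT z|lborel. complex_of_real (indicator (cball 0 R) z) * (z ^ m * cnj z ^ n) * complex_of_real (MLF_weight q z))"
    by (rule integral_mlf) measurable
  also have "(LINT z|lborel. complex_of_real (indicator (cball 0 R) z) * (z ^ m * cnj z ^ n) * complex_of_real (MLF_weight q z)) =
      (LINT z|lborel. z ^ m * cnj z ^ n * complex_of_real (\<rho> (cmod z)))"
    by (intro Bochner_Integration.integral_cong)
      (auto simp: \<rho>_def MLF_weight_def split: split_indicator)
  also have "\<dots> = 0" by (rule integral_radial_monomials_eq_0[OF False]) measurable
  finally show ?thesis using False by simp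
qed

lemma mon_measurable [measurable]: "mon n \<in> borel_measurable borel"
  unfolding mon_def[abs_def] by measurable

lemma cmod_mon: "(cmod (mon n z))\<^sup>2 = cmod z ^ (2 * n) / \<gamma> n"
  using \<gamma>_pos[of n] by (simp add: mon_def norm_divide norm_power power_divide power_mult[symmetric] mult.commute)

lemma mon_sqint: "mon n \<in> sqint mlf"
  using moment_integrable[of n] by (simp add: sqint_def cmod_mon)

text \<open>Lets inner products be computed on discs first, where power series may be integrated
  term by term.\<close>

lemma ip_tendsto_disc:
  assumes "f \<in> sqint mlf" "g \<in> sqint mlf"
  shows "((\<lambda>R. LINT z|mlf. complex_of_real (indicator (cball 0 R) z) * (f z * cnj (g z))) \<longlongrightarrow> ip mlf f g) at_top"
  unfolding ip_def
proof (rule integral_dominated_convergence_at_top[OF _ _ sqint_mult_norm_integrable[OF assms]])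
  have [measurable]: "f \<in> borel_measurable borel" "g \<in> borel_measurable borel"
    using assms by (auto simp: sqint_def)
  show "(\<lambda>z. f z * cnj (g z)) \<in> borel_measurable mlf" by measurable
  show "(\<lambda>z. complex_of_real (indicator (cball 0 R) z) * (f z * cnj (g z))) \<in> borel_measurable mlf" for R
    by measurable
  show "\<forall>\<^sub>F R in at_top. AE z in mlf. norm (complex_of_real (indicator (cball 0 R) z) * (f z * cnj (g z))) \<le> cmod (f z) * cmod (g z)"
    by (intro always_eventually allI AE_I2) (simp add: norm_mult split: split_indicator)
  have "((\<lambda>R. complex_of_real (indicator (cball 0 R) z) * (f z * cnj (g z))) \<longlongrightarrow> complex_of_real 1 * (f z * cnj (g z))) at_top" for z
    by (intro tendsto_intros indicator_cball_tendsto)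
  then show "AE z in mlf. ((\<lambda>R. complex_of_real (indicator (cball 0 R) z) * (f z * cnj (g z))) \<longlongrightarrow> f z * cnj (g z)) at_top"
    by simp
qed

sublocale ml: orthonormal_seq mlf mon
proof
  show "mon n \<in> sqint mlf" for n by (rule mon_sqint)
  fix m n
  let ?c = "complex_of_real (sqrt (\<gamma> m) * sqrt (\<gamma> n))"
  have "(LINT z|mlf. complex_of_real (indicator (cball 0 R) z) * (mon m z * cnj (mon n z))) =
      (LINT z|mlf. (complex_of_real (indicator (cball 0 R) z) * (z ^ m * cnj z ^ n)) / ?c)" for R
    by (intro Bochner_Integration.integral_cong) (simp_all add: mon_def)
  then have "(LINT z|mlf. complex_of_real (indicator (cball 0 R) z) * (mon m z * cnj (mon n z))) =
      (if m = n then complex_of_real (disc_moment n R) else 0) / ?c" for R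
    by (simp add: disc_monomials)
  then have "((\<lambda>R. (if m = n then complex_of_real (disc_moment n R) else 0) / ?c) \<longlongrightarrow> ip mlf (mon m) (mon n)) at_top"
    using ip_tendsto_disc[OF mon_sqint mon_sqint, of m n] by simp
  moreover have "((\<lambda>R. (if m = n then complex_of_real (disc_moment n R) else 0) / ?c) \<longlongrightarrow>
      (if m = n then complex_of_real (\<gamma> n) else 0) / ?c) at_top"
  proof (cases "m = n")
    case True
    have "((\<lambda>R. complex_of_real (disc_moment n R) / ?c) \<longlongrightarrow> complex_of_real (\<gamma> n) / ?c) at_top"
      using \<gamma>_pos[of m] \<gamma>_pos[of n] by (intro tendsto_intros disc_moment_tendsto) auto
    with True show ?thesis by (simp only: refl if_True)
  qed simp
  ultimately have "ip mlf (mon m) (mon n) = (if m = n then complex_of_real (\<gamma> n) else 0) / ?c"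
    by (rule tendsto_unique[OF trivial_limit_at_top_linorder])
  then show "ip mlf (mon m) (mon n) = (if m = n then 1 else 0)"
    using \<gamma>_pos[of n] by (auto simp flip: of_real_mult)
qed

section \<open>Entire functions and their Taylor coefficients\<close>

lemma holomorphic_borel: "f holomorphic_on UNIV \<Longrightarrow> f \<in> borel_measurable borel"
  by (intro borel_measurable_continuous_onI holomorphic_on_imp_continuous_on)

lemma mlf_space_iff: "f \<in> MLF_space q \<longleftrightarrow> f holomorphic_on UNIV \<and> f \<in> sqint mlf"
proof -
  have "f \<in> sqint mlf \<longleftrightarrow> integrable lborel (\<lambda>z. (cmod (f z))\<^sup>2 * MLF_weight q z)"
    if "f holomorphic_on UNIV"
  proof -
    have [measurable]: "f \<in> borel_measurable borel" using that by (rule holomorphic_borel)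
    show ?thesis
      by (simp add: sqint_def integrable_mlf mult.commute)
  qed
  then show ?thesis by (auto simp: MLF_space_def)
qed

lemma MLF_inner_eq:
  assumes "f \<in> borel_measurable borel" "g \<in> borel_measurable borel"
  shows "MLF_inner q f g = ip mlf f g"
proof -
  have "(\<lambda>z. f z * cnj (g z)) \<in> borel_measurable borel" using assms by measurable
  then show ?thesis by (simp add: MLF_inner_def ip_def integral_mlf)
qed

text \<open>On a disc the series has a summable constant majorant, so it may be integrated termwise,
  and orthogonality on the disc leaves only the term with index \<open>k\<close>.\<close>

lemma disc_power_series:
  assumes b: "\<And>z. (\<lambda>n. b n * z ^ n) sums f z"
  shows "(LINT z|mlf. complex_of_real (indicator (cball 0 R) z) * (f z * cnj z ^ k)) =
    b k * complex_of_real (disc_moment k R)"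
proof -
  define g where "g m z = complex_of_real (indicator (cball 0 R) z) * (b m * (z ^ m * cnj z ^ k))" for m z
  \<comment> \<open>The absolute value keeps the majorant nonnegative for \<open>R < 0\<close>,
    where the disc is empty.\<close>
  define B where "B m = norm (b m * complex_of_real \<bar>R\<bar> ^ m) * \<bar>R\<bar> ^ k" for m
  have gB: "norm (g m z) \<le> B m" for m z
  proof (cases "cmod z \<le> R")
    case True
    then have "cmod z ^ m * cmod z ^ k \<le> \<bar>R\<bar> ^ m * \<bar>R\<bar> ^ k"
      by (intro mult_mono power_mono) auto
    then have "cmod (b m) * (cmod z ^ m * cmod z ^ k) \<le> cmod (b m) * (\<bar>R\<bar> ^ m * \<bar>R\<bar> ^ k)"
      by (rule mult_left_mono) simp
    with True show ?thesis by (simp add: g_def B_def norm_mult norm_power mult.assoc)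
  qed (simp add: g_def B_def)
  have gm [measurable]: "g m \<in> borel_measurable borel" for m
    unfolding g_def[abs_def] by measurable
  \<comment> \<open>Convergence at the larger point \<open>\<bar>R\<bar> + 1\<close> forces absolute
    convergence at \<open>\<bar>R\<bar>\<close>.\<close>
  have "summable (\<lambda>m. norm (b m * complex_of_real \<bar>R\<bar> ^ m))"
    using b[of "complex_of_real (\<bar>R\<bar> + 1)"] by (intro powser_insidea) (auto simp: sums_iff)
  then have sB: "summable B" unfolding B_def by (rule summable_mult2)
  have int: "integrable mlf (g m)" for m
    by (rule mlf.integrable_const_bound[of _ "B m"]) (use gB in auto)
  have g_sums: "(\<lambda>m. LINT z|mlf. g m z) sums (LINT z|mlf. (\<Sum>m. g m z))"
  proof (rule sums_integral[OF int])
    show "AE z in mlf. summable (\<lambda>m. norm (g m z))"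
      by (intro AE_I2 summable_comparison_test'[OF sB]) (use gB in auto)
    have "(LINT z|mlf. norm (g m z)) \<le> B m" for m
    proof -
      have "(LINT z|mlf. norm (g m z)) \<le> (LINT z|mlf. B m)"
        using int gB by (intro integral_mono) auto
      then show ?thesis by (simp add: mlf.prob_space[simplified])
    qed
    then show "summable (\<lambda>m. LINT z|mlf. norm (g m z))"
      by (intro summable_comparison_test'[OF sB]) simp
  qed
  have g_sum: "(\<Sum>m. g m z) = complex_of_real (indicator (cball 0 R) z) * (f z * cnj z ^ k)" for z
  proof -
    have "(\<lambda>m. complex_of_real (indicator (cball 0 R) z) * (b m * z ^ m * cnj z ^ k)) sums
        (complex_of_real (indicator (cball 0 R) z) * (f z * cnj z ^ k))"
      by (intro sums_mult sums_mult2 b)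
    then show ?thesis by (simp add: g_def sums_iff mult.assoc)
  qed
  have g_int: "(LINT z|mlf. g m z) = (if m = k then b m * complex_of_real (disc_moment k R) else 0)" for m
  proof -
    have "(LINT z|mlf. g m z) =
        (LINT z|mlf. b m * (complex_of_real (indicator (cball 0 R) z) * (z ^ m * cnj z ^ k)))"
      by (intro Bochner_Integration.integral_cong) (simp_all add: g_def)
    also have "\<dots> = b m * (LINT z|mlf. complex_of_real (indicator (cball 0 R) z) * (z ^ m * cnj z ^ k))"
      by (rule Bochner_Integration.integral_mult_right_zero)
    finally show ?thesis by (simp only: disc_monomials) simp
  qed
  have "(\<lambda>m. if m = k then b m * complex_of_real (disc_moment k R) else 0) sums
      (b k * complex_of_real (disc_moment k R))"
    by (rule sums_single)
  with g_sums show ?thesis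
    unfolding g_sum g_int by (rule sums_unique2)
qed

abbreviation coef :: "(complex \<Rightarrow> complex) \<Rightarrow> nat \<Rightarrow> complex" where
  "coef f n \<equiv> ip mlf f (mon n)"

text \<open>Letting the radius grow in the disc integrals identifies each Taylor coefficient with an
  inner product, up to \<open>sqrt (\<gamma> k)\<close>. The Taylor series is thus the orthonormal
  expansion, and \<open>expands_pointwise\<close> gives norm convergence.\<close>

lemma
  assumes f: "f \<in> MLF_space q"
  shows mlf_space_sums: "(\<lambda>n. coef f n * mon n z) sums f z"
    and mlf_space_expands: "ml.expands f (coef f)"
    and mlf_space_disc: "(LINT z|mlf. complex_of_real (indicator (cball 0 R) z) * (f z * cnj (mon k z))) =
      coef f k * complex_of_real (disc_moment k R / \<gamma> k)"
proof -
  have hol: "f holomorphic_on UNIV" and fs: "f \<in> sqint mlf"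
    using f by (auto simp: mlf_space_iff)
  define b where "b n = (deriv ^^ n) f 0 / fact n" for n
  have b: "(\<lambda>n. b n * z ^ n) sums f z" for z
    using holomorphic_power_series[of f 0 "cmod z + 1" z] hol
    by (simp add: b_def holomorphic_on_subset)
  have disc: "(LINT z|mlf. complex_of_real (indicator (cball 0 R) z) * (f z * cnj (mon k z))) =
      b k * complex_of_real (disc_moment k R) / complex_of_real (sqrt (\<gamma> k))" for k R
  proof -
    have "(LINT z|mlf. complex_of_real (indicator (cball 0 R) z) * (f z * cnj (mon k z))) =
        (LINT z|mlf. (complex_of_real (indicator (cball 0 R) z) * (f z * cnj z ^ k)) / complex_of_real (sqrt (\<gamma> k)))"
      by (intro Bochner_Integration.integral_cong) (simp_all add: mon_def)
    also have "\<dots> = (LINT z|mlf. complex_of_real (indicator (cball 0 R) z) * (f z * cnj z ^ k)) / complex_of_real (sqrt (\<gamma> k))"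
      by (rule integral_divide_zero)
    finally show ?thesis by (simp only: disc_power_series[OF b])
  qed
  have sg: "complex_of_real (sqrt (\<gamma> k)) * complex_of_real (sqrt (\<gamma> k)) = complex_of_real (\<gamma> k)"
    "sqrt (\<gamma> k) \<noteq> 0" for k
    using \<gamma>_pos[of k] by (simp_all flip: of_real_mult)
  have coef: "coef f k = b k * complex_of_real (sqrt (\<gamma> k))" for k
  proof -
    have "((\<lambda>R. b k * complex_of_real (disc_moment k R) / complex_of_real (sqrt (\<gamma> k))) \<longlongrightarrow> coef f k) at_top"
      using ip_tendsto_disc[OF fs mon_sqint[of k]] by (simp only: disc)
    moreover have "((\<lambda>R. b k * complex_of_real (disc_moment k R) / complex_of_real (sqrt (\<gamma> k))) \<longlongrightarrow>
        b k * complex_of_real (\<gamma> k) / complex_of_real (sqrt (\<gamma> k))) at_top"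
      using sg(2)[of k] by (intro tendsto_intros disc_moment_tendsto) auto
    ultimately have "coef f k = b k * complex_of_real (\<gamma> k) / complex_of_real (sqrt (\<gamma> k))"
      by (rule tendsto_unique[OF trivial_limit_at_top_linorder])
    then show ?thesis
      unfolding sg(1)[symmetric] using sg(2)[of k] by simp
  qed
  show sums: "(\<lambda>n. coef f n * mon n z) sums f z" for z
    using b[of z] sg(2) by (simp add: coef mon_def)
  show "ml.expands f (coef f)"
  proof (rule ml.expands_pointwise[OF ml.Bessel[OF fs] _ filterlim_ident])
    show "f \<in> borel_measurable mlf" using fs by (rule sqint_measurable)
    show "AE z in mlf. (\<lambda>N. ml.psum (coef f) N z) \<longlonglongrightarrow> f z"
      using sums by (simp add: ml.psum_def sums_def)
  qed
  show "(LINT z|mlf. complex_of_real (indicator (cball 0 R) z) * (f z * cnj (mon k z))) =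
      coef f k * complex_of_real (disc_moment k R / \<gamma> k)"
    using sg[of k] unfolding disc coef of_real_divide sg(1)[symmetric] by simp
qed

lemma norm_mon: "cmod (mon n z) = cmod z ^ n / sqrt (\<gamma> n)"
  using \<gamma>_pos[of n] by (simp add: mon_def norm_divide norm_power)

lemma summable_norm_mon: "summable (\<lambda>n. K ^ n * cmod (mon n z))"
proof -
  have "(\<lambda>n. K ^ n * cmod (mon n z)) = (\<lambda>n. (K * cmod z) ^ n / sqrt (Gamma (q * real n + 1)))"
    by (simp add: fun_eq_iff norm_mon \<gamma>_def power_mult_distrib)
  then show ?thesis using summable_mlf_kernel[OF q_pos, of "K * cmod z"] by simp
qed

text \<open>The converse direction, which places the range of the transform: convergence everywhere
  makes \<open>F\<close> entire, and square summability makes its norm finite.\<close>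

lemma mlf_series:
  assumes a: "summable (\<lambda>n. (cmod (a n))\<^sup>2)" and F: "\<And>z. (\<lambda>n. a n * mon n z) sums F z"
  shows "F \<in> MLF_space q" "ml.expands F a"
proof -
  have hol: "F holomorphic_on UNIV"
    unfolding holomorphic_on_def
  proof (intro ballI)
    fix z :: complex
    have "F holomorphic_on ball 0 (cmod z + 1)"
    proof (rule power_series_holomorphic)
      fix w
      show "(\<lambda>n. a n / complex_of_real (sqrt (\<gamma> n)) * (w - 0) ^ n) sums F w"
        using F[of w] by (simp add: mon_def)
    qed
    then have "F field_differentiable (at z)"
      by (rule holomorphic_on_imp_differentiable_at) simp_all
    then show "F field_differentiable at z within UNIV" by simp
  qed
  show E: "ml.expands F a"
  proof (rule ml.expands_pointwise[OF a _ filterlim_ident])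
    show "F \<in> borel_measurable mlf" using holomorphic_borel[OF hol] by simp
    show "AE z in mlf. (\<lambda>N. ml.psum a N z) \<longlonglongrightarrow> F z"
      using F by (simp add: ml.psum_def sums_def)
  qed
  then show "F \<in> MLF_space q" using hol by (simp add: mlf_space_iff ml.expands_def)
qed

end

section \<open>The Mittag-Leffler Bargmann transform\<close>

lemma L2R_eq: "L2R = sqint lborel"
  by (auto simp: L2R_def sqint_def)

lemma L2_inner_eq: "L2_inner = ip lborel"
  by (simp add: L2_inner_def ip_def fun_eq_iff)

lemma psi_measurable [measurable]: "psi n \<in> borel_measurable borel"
  unfolding psi_def[abs_def] by measurable

lemma cnj_psi [simp]: "cnj (psi n x) = psi n x"
  by (simp add: psi_def)

lemma norm_psi_le: "cmod (psi n x) \<le> (1 + 2 * \<bar>x\<bar>) ^ n"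
  using hermite_fun_le[of n x] by (simp add: psi_def)

lemma ip_cong_AE:
  assumes "AE x in M. u x = v x" "u \<in> borel_measurable M" "v \<in> borel_measurable M" "w \<in> borel_measurable M"
  shows "ip M u w = ip M v w"
  unfolding ip_def by (rule integral_cong_AE) (use assms in auto)

text \<open>\<open>L2_lim\<close> picks some limit; its class is fixed by this uniqueness.\<close>

lemma L2_tendsto_AE_unique:
  assumes "L2_tendsto F g" "L2_tendsto F h"
  shows "AE x in lborel. g x = h x"
proof -
  have F: "F R \<in> sqint lborel" and g: "g \<in> sqint lborel" and h: "h \<in> sqint lborel" for R
    using assms by (auto simp: L2_tendsto_def L2R_eq)
  have lim: "((\<lambda>R. 2 * nsq lborel (\<lambda>x. F R x - g x) + 2 * nsq lborel (\<lambda>x. F R x - h x)) \<longlongrightarrow> 2 * 0 + 2 * 0) at_top"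
    using assms unfolding L2_tendsto_def nsq_def by (intro tendsto_intros) auto
  have "nsq lborel (\<lambda>x. g x - h x) \<le> 2 * nsq lborel (\<lambda>x. F R x - g x) + 2 * nsq lborel (\<lambda>x. F R x - h x)" for R
  proof -
    have i: "integrable lborel (\<lambda>x. (cmod (F R x - g x))\<^sup>2)" "integrable lborel (\<lambda>x. (cmod (F R x - h x))\<^sup>2)"
      "integrable lborel (\<lambda>x. (cmod (g x - h x))\<^sup>2)"
      by (intro sqint_integrable sqint_diff F g h)+
    have "(cmod (g x - h x))\<^sup>2 \<le> 2 * (cmod (F R x - g x))\<^sup>2 + 2 * (cmod (F R x - h x))\<^sup>2" for x
    proof -
      have "cmod (g x - h x) \<le> cmod (F R x - g x) + cmod (F R x - h x)"
        using norm_triangle_ineq4[of "F R x - h x" "F R x - g x"] by simp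
      then have "(cmod (g x - h x))\<^sup>2 \<le> (cmod (F R x - g x) + cmod (F R x - h x))\<^sup>2"
        by (intro power_mono) auto
      then show ?thesis
        using two_mult_le_squares[of "cmod (F R x - g x)" "cmod (F R x - h x)"]
        unfolding power2_sum by linarith
    qed
    then have "nsq lborel (\<lambda>x. g x - h x) \<le>
        (LINT x|lborel. 2 * (cmod (F R x - g x))\<^sup>2 + 2 * (cmod (F R x - h x))\<^sup>2)"
      unfolding nsq_def using i by (intro integral_mono) auto
    then show ?thesis using i by (simp add: nsq_def)
  qed
  then have "nsq lborel (\<lambda>x. g x - h x) \<le> 2 * 0 + 2 * 0"
    by (intro tendsto_lowerbound[OF lim]) simp_all
  then have "nsq lborel (\<lambda>x. g x - h x) = 0"
    using nsq_nonneg[of lborel "\<lambda>x. g x - h x"] by simp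
  then have "AE x in lborel. g x - h x = 0"
    by (intro nsq_eq_0_AE sqint_diff g h)
  then show ?thesis by simp
qed

text \<open>Fatou along integer radii: the integral over \<open>I\<close> of the squared distance
  between \<open>T\<close> and \<open>g\<close> is at most the lower limit of the squared norms of
  \<open>F (real n) - g\<close>, which is 0.\<close>

lemma L2_tendsto_pointwise_AE:
  assumes F: "L2_tendsto F g"
    and [measurable]: "I \<in> sets borel" "T \<in> borel_measurable borel"
    and T: "\<And>x. x \<in> I \<Longrightarrow> ((\<lambda>R. F R x) \<longlongrightarrow> T x) at_top"
  shows "AE x in lborel. x \<in> I \<longrightarrow> T x = g x"
proof -
  have Fs: "F R \<in> sqint lborel" and g: "g \<in> sqint lborel" for R
    using F by (auto simp: L2_tendsto_def L2R_eq)
  have [measurable]: "F R \<in> borel_measurable borel" "g \<in> borel_measurable borel" for R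
    using Fs[of R] g by (auto simp: sqint_def)
  let ?N = "\<lambda>n::nat. nsq lborel (\<lambda>x. F (real n) x - g x)"
  have "?N \<longlonglongrightarrow> 0"
    using F unfolding L2_tendsto_def nsq_def by (auto intro: filterlim_compose[OF _ filterlim_real_sequentially])
  then have N0: "(\<lambda>n. ennreal (?N n)) \<longlonglongrightarrow> ennreal 0" by (rule tendsto_ennrealI)
  have "(\<integral>\<^sup>+x. indicator I x * ennreal ((cmod (T x - g x))\<^sup>2) \<partial>lborel) \<le>
      (\<integral>\<^sup>+x. liminf (\<lambda>n. ennreal ((cmod (F (real n) x - g x))\<^sup>2)) \<partial>lborel)"
  proof (rule nn_integral_mono)
    fix x
    show "indicator I x * ennreal ((cmod (T x - g x))\<^sup>2) \<le> liminf (\<lambda>n. ennreal ((cmod (F (real n) x - g x))\<^sup>2))"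
    proof (cases "x \<in> I")
      case True
      have "(\<lambda>n. F (real n) x) \<longlonglongrightarrow> T x"
        using T[OF True] by (rule filterlim_compose[OF _ filterlim_real_sequentially])
      then have "(\<lambda>n. ennreal ((cmod (F (real n) x - g x))\<^sup>2)) \<longlonglongrightarrow> ennreal ((cmod (T x - g x))\<^sup>2)"
        by (intro tendsto_intros tendsto_ennrealI)
      then have "liminf (\<lambda>n. ennreal ((cmod (F (real n) x - g x))\<^sup>2)) = ennreal ((cmod (T x - g x))\<^sup>2)"
        by (rule lim_imp_Liminf[OF sequentially_bot])
      then show ?thesis using True by (simp only: indicator_simps mult_1_left order_refl)
    qed simp
  qed
  also have "\<dots> \<le> liminf (\<lambda>n. \<integral>\<^sup>+x. ennreal ((cmod (F (real n) x - g x))\<^sup>2) \<partial>lborel)"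
    by (rule nn_integral_liminf) measurable
  also have "\<dots> = liminf (\<lambda>n. ennreal (?N n))"
    by (simp only: nn_nsq[OF sqint_diff[OF Fs g]])
  also have "\<dots> = 0" using lim_imp_Liminf[OF _ N0] by simp
  finally have "(\<integral>\<^sup>+x. indicator I x * ennreal ((cmod (T x - g x))\<^sup>2) \<partial>lborel) = 0" by simp
  then have "AE x in lborel. indicator I x * ennreal ((cmod (T x - g x))\<^sup>2) = 0"
    by (subst (asm) nn_integral_0_iff_AE) auto
  then show ?thesis
    by eventually_elim auto
qed

context mlf_order
begin

section \<open>The kernel series and the transform in coefficients\<close>

abbreviation hcoef :: "(real \<Rightarrow> complex) \<Rightarrow> nat \<Rightarrow> complex" where
  "hcoef \<phi> n \<equiv> ip lborel \<phi> (psi n)"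

lemma kernel_summable: "summable (\<lambda>n. cmod (cnj (mon n z) * psi n x))"
proof (rule summable_comparison_test'[OF summable_norm_mon[of "1 + 2 * \<bar>x\<bar>" z]])
  show "norm (cmod (cnj (mon n z) * psi n x)) \<le> (1 + 2 * \<bar>x\<bar>) ^ n * cmod (mon n z)" for n
    using mult_right_mono[OF norm_psi_le[of n x], of "cmod (mon n z)"] by (simp add: norm_mult mult.commute)
qed

lemma kernel_eq: "MLB_kernel q z x = (\<Sum>n. cnj (mon n z) * psi n x)"
  by (simp add: MLB_kernel_def mon_def psi_def \<gamma>_def)

lemma kernel_sums: "(\<lambda>n. cnj (mon n z) * psi n x) sums MLB_kernel q z x"
  unfolding kernel_eq by (rule summable_sums[OF summable_norm_cancel[OF kernel_summable]])

text \<open>Joint measurability ensures that the points \<open>x\<close> at which the integral in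
  \<open>MLT\<close> converges absolutely form a Borel set.\<close>

lemma kernel_measurable: "(\<lambda>(x, z). MLB_kernel q z x) \<in> borel_measurable (borel \<Otimes>\<^sub>M borel)"
  unfolding kernel_eq case_prod_beta by measurable

lemma kernel_measurable_z [measurable]: "(\<lambda>z. MLB_kernel q z x) \<in> borel_measurable borel"
  unfolding kernel_eq by measurable

text \<open>Each \<open>psi n\<close> has norm 1, so the integrals of the moduli of the terms are
  bounded by \<open>(nsq lborel \<phi> + 1) * cmod (mon n z)\<close>. This is summable and justifies
  termwise integration.\<close>

lemma MLB_sums:
  assumes \<phi>: "\<phi> \<in> sqint lborel"
  shows "(\<lambda>n. hcoef \<phi> n * mon n z) sums MLB q \<phi> z"
proof -
  define g where "g n x = mon n z * (\<phi> x * cnj (psi n x))" for n x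
  have int: "integrable lborel (g n)" for n
    unfolding g_def[abs_def] by (intro integrable_mult_right impI sqint_mult_integrable \<phi>) simp
  have sm: "summable (\<lambda>n. cmod (g n x))" for x
  proof -
    have "(\<lambda>n. cmod (g n x)) = (\<lambda>n. cmod (cnj (mon n z) * psi n x) * cmod (\<phi> x))"
      by (simp add: g_def norm_mult fun_eq_iff mult_ac)
    then show ?thesis using summable_mult2[OF kernel_summable] by simp
  qed
  have psi1: "nsq lborel (psi n) = 1" for n
    using herm.e_orth[of n n] by (simp add: ip_self)
  have bound: "(LINT x|lborel. cmod (g n x)) \<le> (nsq lborel \<phi> + 1) * cmod (mon n z)" for n
  proof -
    have "(LINT x|lborel. cmod (\<phi> x) * cmod (psi n x)) \<le> (LINT x|lborel. (cmod (\<phi> x))\<^sup>2 + (cmod (psi n x))\<^sup>2)"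
    proof (intro integral_mono sqint_mult_norm_integrable \<phi> herm.e_sqint Bochner_Integration.integrable_add sqint_integrable)
      fix x
      have "0 \<le> cmod (\<phi> x) * cmod (psi n x)" by simp
      then show "cmod (\<phi> x) * cmod (psi n x) \<le> (cmod (\<phi> x))\<^sup>2 + (cmod (psi n x))\<^sup>2"
        using two_mult_le_squares[of "cmod (\<phi> x)" "cmod (psi n x)"] by linarith
    qed
    also have "\<dots> = nsq lborel \<phi> + nsq lborel (psi n)"
      unfolding nsq_def by (intro Bochner_Integration.integral_add sqint_integrable \<phi> herm.e_sqint)
    finally have "(LINT x|lborel. cmod (\<phi> x) * cmod (psi n x)) \<le> nsq lborel \<phi> + 1"
      by (simp add: psi1)
    then have "cmod (mon n z) * (LINT x|lborel. cmod (\<phi> x) * cmod (psi n x)) \<le> cmod (mon n z) * (nsq lborel \<phi> + 1)"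
      by (rule mult_left_mono) simp
    then show ?thesis by (simp add: g_def norm_mult mult.commute)
  qed
  have g_sums: "(\<lambda>n. LINT x|lborel. g n x) sums (LINT x|lborel. (\<Sum>n. g n x))"
  proof (rule sums_integral[OF int])
    show "AE x in lborel. summable (\<lambda>n. norm (g n x))" using sm by simp
    have "summable (\<lambda>n. (nsq lborel \<phi> + 1) * cmod (mon n z))"
      using summable_norm_mon[of 1 z] by (intro summable_mult) simp
    then show "summable (\<lambda>n. LINT x|lborel. norm (g n x))"
      by (rule summable_comparison_test') (use bound in simp)
  qed
  have g_int: "(LINT x|lborel. g n x) = hcoef \<phi> n * mon n z" for n
  proof -
    have "(LINT x|lborel. g n x) = mon n z * (LINT x|lborel. \<phi> x * cnj (psi n x))"
      unfolding g_def by (rule Bochner_Integration.integral_mult_right_zero)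
    then show ?thesis by (simp only: ip_def mult.commute)
  qed
  have g_sum: "(\<Sum>n. g n x) = cnj (MLB_kernel q z x) * \<phi> x" for x
  proof -
    have "(\<lambda>n. cnj (cnj (mon n z) * psi n x) * \<phi> x) sums (cnj (MLB_kernel q z x) * \<phi> x)"
      by (intro sums_mult2) (simp only: sums_cnj kernel_sums)
    then show ?thesis by (simp add: g_def sums_iff mult_ac)
  qed
  show ?thesis using g_sums unfolding g_int g_sum MLB_def .
qed

lemma MLB_from_expansion:
  assumes \<phi>: "herm.expands \<phi> a" and F: "\<And>z. (\<lambda>n. a n * mon n z) sums F z"
  shows "MLB q \<phi> = F"
proof
  fix z
  have "\<phi> \<in> sqint lborel" using \<phi> by (simp add: herm.expands_def)
  from MLB_sums[OF this, of z] F[of z] show "MLB q \<phi> z = F z"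
    unfolding herm.expands_coeff[OF \<phi>] by (rule sums_unique2)
qed

lemma
  assumes \<phi>: "\<phi> \<in> sqint lborel"
  shows MLB_in_space: "MLB q \<phi> \<in> MLF_space q"
    and MLB_expands: "ml.expands (MLB q \<phi>) (hcoef \<phi>)"
    and MLB_coef: "coef (MLB q \<phi>) = hcoef \<phi>"
proof -
  show "MLB q \<phi> \<in> MLF_space q"
    by (rule mlf_series(1)[where a = "hcoef \<phi>"]) (rule herm.Bessel[OF \<phi>], rule MLB_sums[OF \<phi>])
  show E: "ml.expands (MLB q \<phi>) (hcoef \<phi>)"
    by (rule mlf_series(2)[where a = "hcoef \<phi>"]) (rule herm.Bessel[OF \<phi>], rule MLB_sums[OF \<phi>])
  show "coef (MLB q \<phi>) = hcoef \<phi>"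
    by (rule ext) (rule ml.expands_coeff[OF E])
qed

section \<open>Damping factors, the truncated inverse transform and its limit\<close>

definition damp :: "real \<Rightarrow> nat \<Rightarrow> real" where
  "damp R n = disc_moment n R / \<gamma> n"

text \<open>For \<open>R > 0\<close> the factor \<open>damp R n\<close> is the regularized lower
  incomplete Gamma function with parameter \<open>q * real n + 1\<close> at
  \<open>R powr (2 / q)\<close>: the share of the moment carried by the disc.\<close>

lemma damp_bounds: "0 \<le> damp R n" "damp R n \<le> 1"
  using disc_moment_bounds[of n R] \<gamma>_pos[of n] by (simp_all add: damp_def)

lemma damp_tendsto: "((\<lambda>R. damp R n) \<longlongrightarrow> 1) at_top"
proof -
  have "((\<lambda>R. disc_moment n R / \<gamma> n) \<longlongrightarrow> \<gamma> n / \<gamma> n) at_top"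
    by (rule tendsto_divide[OF disc_moment_tendsto tendsto_const]) (use \<gamma>_pos[of n] in simp)
  moreover have "\<gamma> n / \<gamma> n = 1" using \<gamma>_pos[of n] by simp
  ultimately show ?thesis unfolding damp_def by (simp only:)
qed

text \<open>On the disc the kernel terms times \<open>f\<close> are dominated by
  \<open>B n * cmod (f z)\<close>, where \<open>f\<close> is integrable because the measure is
  finite. Termwise integration then yields convergence at every \<open>x\<close>.\<close>

lemma MLT_trunc_sums:
  assumes f: "f \<in> MLF_space q"
  shows "(\<lambda>n. (coef f n * complex_of_real (damp R n)) * psi n x) sums MLT_trunc q f R x"
proof -
  have fs: "f \<in> sqint mlf" and fm [measurable]: "f \<in> borel_measurable borel"
    using f by (auto simp: mlf_space_iff holomorphic_borel)
  let ?i = "\<lambda>z. complex_of_real (indicator (cball 0 R) z)"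
  define g where "g n z = psi n x * (?i z * (f z * cnj (mon n z)))" for n z
  have "(\<lambda>z. 1) \<in> sqint mlf" by (simp add: sqint_def)
  from sqint_mult_norm_integrable[OF fs this] have f1: "integrable mlf (\<lambda>z. cmod (f z))" by simp
  have gm [measurable]: "g n \<in> borel_measurable borel" for n
    unfolding g_def[abs_def] by measurable
  define B where "B n = (1 + 2 * \<bar>x\<bar>) ^ n * cmod (mon n (complex_of_real \<bar>R\<bar>))" for n
  have sB: "summable B" unfolding B_def by (rule summable_norm_mon)
  have B0: "0 \<le> B n" for n by (simp add: B_def)
  have gB: "cmod (g n z) \<le> B n * cmod (f z)" for n z
  proof (cases "cmod z \<le> R")
    case True
    then have "cmod z ^ n \<le> \<bar>R\<bar> ^ n" by (intro power_mono) auto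
    then have "cmod (mon n z) \<le> cmod (mon n (complex_of_real \<bar>R\<bar>))"
      using \<gamma>_pos[of n] by (simp add: norm_mon divide_right_mono)
    then have "cmod (psi n x) * cmod (mon n z) \<le> B n"
      unfolding B_def by (intro mult_mono norm_psi_le) auto
    then have "cmod (psi n x) * cmod (mon n z) * cmod (f z) \<le> B n * cmod (f z)"
      by (rule mult_right_mono) simp
    with True show ?thesis by (simp add: g_def norm_mult mult_ac)
  next
    case False
    then show ?thesis using B0[of n] by (simp add: g_def)
  qed
  have int: "integrable mlf (g n)" for n
  proof (rule Bochner_Integration.integrable_bound)
    show "integrable mlf (\<lambda>z. B n * cmod (f z))" using f1 by simp
    show "AE z in mlf. norm (g n z) \<le> norm (B n * cmod (f z))"
      using gB B0 by (intro AE_I2) (simp add: abs_mult)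
  qed simp
  have g_sums: "(\<lambda>n. LINT z|mlf. g n z) sums (LINT z|mlf. (\<Sum>n. g n z))"
  proof (rule sums_integral[OF int])
    have "summable (\<lambda>n. norm (g n z))" for z
      by (rule summable_comparison_test'[OF summable_mult2[OF sB, of "cmod (f z)"]]) (use gB in simp)
    then show "AE z in mlf. summable (\<lambda>n. norm (g n z))" by simp
    have "(LINT z|mlf. norm (g n z)) \<le> B n * (LINT z|mlf. cmod (f z))" for n
    proof -
      have "(LINT z|mlf. norm (g n z)) \<le> (LINT z|mlf. B n * cmod (f z))"
        using int gB f1 by (intro integral_mono) auto
      then show ?thesis by simp
    qed
    then show "summable (\<lambda>n. LINT z|mlf. norm (g n z))"
      by (intro summable_comparison_test'[OF summable_mult2[OF sB, of "LINT z|mlf. cmod (f z)"]]) simp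
  qed
  have g_sum: "(\<Sum>n. g n z) = ?i z * (MLB_kernel q z x * f z)" for z
  proof -
    have "(\<lambda>n. ?i z * (cnj (mon n z) * psi n x * f z)) sums (?i z * (MLB_kernel q z x * f z))"
      by (intro sums_mult sums_mult2 kernel_sums)
    then show ?thesis by (simp add: g_def sums_iff mult_ac)
  qed
  have g_int: "(LINT z|mlf. g n z) = (coef f n * complex_of_real (damp R n)) * psi n x" for n
  proof -
    have "(LINT z|mlf. g n z) = psi n x * (LINT z|mlf. ?i z * (f z * cnj (mon n z)))"
      unfolding g_def by (rule Bochner_Integration.integral_mult_right_zero)
    then show ?thesis
      by (simp only: mlf_space_disc[OF f] damp_def mult.commute)
  qed
  have "MLT_trunc q f R x = (LINT z|mlf. ?i z * (MLB_kernel q z x * f z))"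
  proof -
    have "(LINT z|mlf. ?i z * (MLB_kernel q z x * f z)) = complex_of_real (1 / (q * pi)) *
        (LINT z|lborel. ?i z * (MLB_kernel q z x * f z) * complex_of_real (MLF_weight q z))"
      by (rule integral_mlf) measurable
    also have "(LINT z|lborel. ?i z * (MLB_kernel q z x * f z) * complex_of_real (MLF_weight q z)) =
        (LINT z:cball 0 R|lborel. MLT_integrand q f x z)"
      unfolding set_lebesgue_integral_def MLT_integrand_def
      by (intro Bochner_Integration.integral_cong) (simp_all add: scaleR_conv_of_real mult_ac)
    finally show ?thesis by (simp only: MLT_trunc_def)
  qed
  with g_sums show ?thesis unfolding g_sum g_int by simp
qed

lemma MLT_trunc_expands:
  assumes f: "f \<in> MLF_space q"
  shows "herm.expands (MLT_trunc q f R) (\<lambda>n. coef f n * complex_of_real (damp R n))"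
proof (rule herm.expands_pointwise[OF _ _ filterlim_ident])
  have "(\<lambda>n. (cmod (coef f n))\<^sup>2) sums nsq mlf f"
    by (rule ml.expands_nsq[OF mlf_space_expands[OF f]])
  then have s: "summable (\<lambda>n. (cmod (coef f n))\<^sup>2)" by (simp add: sums_iff)
  show "summable (\<lambda>n. (cmod (coef f n * complex_of_real (damp R n)))\<^sup>2)"
  proof (rule summable_comparison_test'[OF s])
    fix n
    have "cmod (coef f n) * damp R n \<le> cmod (coef f n) * 1"
      using damp_bounds[of R n] by (intro mult_left_mono) auto
    then have "(cmod (coef f n) * damp R n)\<^sup>2 \<le> (cmod (coef f n) * 1)\<^sup>2"
      using damp_bounds[of R n] by (intro power_mono) auto
    then show "norm ((cmod (coef f n * complex_of_real (damp R n)))\<^sup>2) \<le> (cmod (coef f n))\<^sup>2"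
      using damp_bounds[of R n] by (simp add: norm_mult)
  qed
  have "MLT_trunc q f R = (\<lambda>x. \<Sum>n. (coef f n * complex_of_real (damp R n)) * psi n x)"
    using MLT_trunc_sums[OF f, of R] by (simp add: sums_iff fun_eq_iff)
  then show "MLT_trunc q f R \<in> borel_measurable lborel" by simp
  show "AE x in lborel. (\<lambda>N. herm.psum (\<lambda>n. coef f n * complex_of_real (damp R n)) N x) \<longlonglongrightarrow> MLT_trunc q f R x"
    using MLT_trunc_sums[OF f, of R] by (simp add: herm.psum_def sums_def)
qed

text \<open>By Parseval the squared distance is a series over \<open>n\<close> with majorant
  \<open>(cmod (coef f n))\<^sup>2\<close>. The damping factors do not tend to 1 uniformly in
  \<open>n\<close>, so Tannery's theorem interchanges limit and sum.\<close>

lemma MLT_trunc_tendsto: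
  assumes f: "f \<in> MLF_space q" and \<phi>: "herm.expands \<phi> (coef f)"
  shows "L2_tendsto (MLT_trunc q f) \<phi>"
proof -
  let ?d = "\<lambda>n R. (cmod (coef f n * complex_of_real (damp R n) - coef f n))\<^sup>2"
  have s: "summable (\<lambda>n. (cmod (coef f n))\<^sup>2)" by (rule herm.expands_summable[OF \<phi>])
  have "((\<lambda>R. \<Sum>n. ?d n R) \<longlongrightarrow> (\<Sum>n::nat. 0)) at_top"
  proof (rule tannerys_theorem[THEN conjunct2, THEN conjunct2])
    show "((\<lambda>R. ?d n R) \<longlongrightarrow> 0) at_top" for n
    proof -
      have "((\<lambda>R. ?d n R) \<longlongrightarrow> (cmod (coef f n * complex_of_real 1 - coef f n))\<^sup>2) at_top"
        by (intro tendsto_intros damp_tendsto)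
      then show ?thesis by simp
    qed
    have "norm (?d n R) \<le> (cmod (coef f n))\<^sup>2" for n R
    proof -
      have "coef f n * complex_of_real (damp R n) - coef f n = coef f n * complex_of_real (damp R n - 1)"
        by (simp add: right_diff_distrib)
      moreover have "(cmod (coef f n) * \<bar>damp R n - 1\<bar>)\<^sup>2 \<le> (cmod (coef f n) * 1)\<^sup>2"
        using damp_bounds[of R n] by (intro power_mono mult_left_mono) auto
      ultimately show ?thesis by (simp add: norm_mult del: of_real_diff)
    qed
    then show "eventually (\<lambda>(n, R). norm (?d n R) \<le> (cmod (coef f n))\<^sup>2) (at_top \<times>\<^sub>F at_top)"
      by (intro always_eventually) auto
  qed (use s in simp_all)
  moreover have "(LINT x|lborel. (cmod (MLT_trunc q f R x - \<phi> x))\<^sup>2) = (\<Sum>n. ?d n R)" for R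
    using herm.expands_nsq[OF herm.expands_diff[OF MLT_trunc_expands[OF f] \<phi>]]
    by (simp add: sums_iff nsq_def)
  moreover have "MLT_trunc q f R \<in> L2R" for R
    using MLT_trunc_expands[OF f] by (simp add: herm.expands_def L2R_eq)
  moreover have "\<phi> \<in> L2R" using \<phi> by (simp add: herm.expands_def L2R_eq)
  ultimately show ?thesis by (simp add: L2_tendsto_def)
qed

text \<open>On the set of absolute convergence, dominated convergence gives a pointwise limit of the
  truncations; elsewhere the chosen limit is compared with \<open>\<phi>\<close> by
  uniqueness.\<close>

lemma
  assumes f: "f \<in> MLF_space q" and \<phi>: "herm.expands \<phi> (coef f)"
  shows MLT_AE: "AE x in lborel. MLT q f x = \<phi> x"
    and MLT_measurable: "MLT q f \<in> borel_measurable borel"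
proof -
  have [measurable]: "f \<in> borel_measurable borel"
    using f by (auto simp: mlf_space_iff holomorphic_borel)
  have tr: "L2_tendsto (MLT_trunc q f) \<phi>" by (rule MLT_trunc_tendsto[OF f \<phi>])
  \<comment> \<open>The existence of the limit \<open>\<phi>\<close> is what gives the choice in
    \<open>L2_lim\<close> its defining property.\<close>
  have L: "L2_tendsto (MLT_trunc q f) (L2_lim (MLT_trunc q f))"
    unfolding L2_lim_def by (rule someI[where P = "L2_tendsto (MLT_trunc q f)", OF tr])
  then have [measurable]: "L2_lim (MLT_trunc q f) \<in> borel_measurable borel"
    by (auto simp: L2_tendsto_def L2R_def)
  have [measurable]: "(\<lambda>(x, z). MLT_integrand q f x z) \<in> borel_measurable (borel \<Otimes>\<^sub>M lborel)"
  proof -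
    have "(\<lambda>(x, z). MLB_kernel q z x) \<in> borel_measurable (borel \<Otimes>\<^sub>M lborel)"
      using kernel_measurable by simp
    then show ?thesis unfolding MLT_integrand_def case_prod_beta by measurable
  qed
  define I where "I = {x. integrable lborel (MLT_integrand q f x)}"
  define T where "T x = complex_of_real (1 / (q * pi)) * (LINT z|lborel. MLT_integrand q f x z)" for x
  have I [measurable]: "I \<in> sets borel"
    unfolding I_def by measurable
  have T [measurable]: "T \<in> borel_measurable borel"
    unfolding T_def[abs_def] by measurable
  have eq: "MLT q f = (\<lambda>x. if x \<in> I then T x else L2_lim (MLT_trunc q f) x)"
    by (simp add: MLT_def T_def I_def fun_eq_iff)
  show "MLT q f \<in> borel_measurable borel" unfolding eq by measurable
  have "((\<lambda>R. MLT_trunc q f R x) \<longlongrightarrow> T x) at_top" if x: "x \<in> I" for x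
  proof -
    have int: "integrable lborel (MLT_integrand q f x)" using x by (simp add: I_def)
    then have [measurable]: "MLT_integrand q f x \<in> borel_measurable borel" by auto
    have "((\<lambda>R. LINT z|lborel. indicator (cball 0 R) z *\<^sub>R MLT_integrand q f x z) \<longlongrightarrow>
        (LINT z|lborel. MLT_integrand q f x z)) at_top"
    proof (rule integral_dominated_convergence_at_top)
      show "integrable lborel (\<lambda>z. cmod (MLT_integrand q f x z))" using int by simp
      show "AE z in lborel. ((\<lambda>R. indicator (cball 0 R) z *\<^sub>R MLT_integrand q f x z) \<longlongrightarrow> MLT_integrand q f x z) at_top"
        using tendsto_scaleR[OF indicator_cball_tendsto tendsto_const] by (intro AE_I2) fastforce
      show "\<forall>\<^sub>F R in at_top. AE z in lborel. norm (indicator (cball 0 R) z *\<^sub>R MLT_integrand q f x z) \<le> cmod (MLT_integrand q f x z)"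
        by (intro always_eventually allI AE_I2) (simp split: split_indicator)
    qed simp_all
    then show ?thesis
      unfolding MLT_trunc_def T_def set_lebesgue_integral_def by (intro tendsto_intros)
  qed
  from L2_tendsto_pointwise_AE[OF tr I T this]
  have "AE x in lborel. x \<in> I \<longrightarrow> T x = \<phi> x" by simp
  moreover have "AE x in lborel. L2_lim (MLT_trunc q f) x = \<phi> x"
    by (rule L2_tendsto_AE_unique[OF L tr])
  ultimately show "AE x in lborel. MLT q f x = \<phi> x"
    by eventually_elim (simp add: eq)
qed

text \<open>Riesz-Fischer supplies a comparison function with the coefficients of \<open>f\<close>;
  agreement almost everywhere transfers them to \<open>MLT q f\<close>.\<close>

lemma MLT_expands:
  assumes f: "f \<in> MLF_space q"
  shows "herm.expands (MLT q f) (coef f)"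
proof -
  have fs: "f \<in> sqint mlf" using f by (simp add: mlf_space_iff)
  obtain \<phi> where \<phi>: "herm.expands \<phi> (coef f)"
    using herm.Riesz_Fischer[OF ml.Bessel[OF fs]] by metis
  then have \<phi>s: "\<phi> \<in> sqint lborel" by (simp add: herm.expands_def)
  have [measurable]: "MLT q f \<in> borel_measurable borel" "\<phi> \<in> borel_measurable borel"
    using MLT_measurable[OF f \<phi>] \<phi>s by (auto simp: sqint_def)
  note ae = MLT_AE[OF f \<phi>]
  have "integrable lborel (\<lambda>x. (cmod (MLT q f x))\<^sup>2) \<longleftrightarrow> integrable lborel (\<lambda>x. (cmod (\<phi> x))\<^sup>2)"
    by (rule integrable_cong_AE) (use ae in auto)
  then have s: "MLT q f \<in> sqint lborel" using \<phi>s by (simp add: sqint_def)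
  have "hcoef (MLT q f) = coef f"
    using ip_cong_AE[OF ae] herm.expands_coeff[OF \<phi>] by (simp add: fun_eq_iff)
  then show ?thesis using hermite_expands[OF s] by simp
qed

section \<open>Unitarity, inverse and adjoint\<close>

lemma MLB_MLT: "f \<in> MLF_space q \<Longrightarrow> MLB q (MLT q f) = f"
  by (rule MLB_from_expansion[OF MLT_expands mlf_space_sums])

lemma MLB_isometry:
  assumes "\<phi> \<in> sqint lborel" "\<psi> \<in> sqint lborel"
  shows "MLF_inner q (MLB q \<phi>) (MLB q \<psi>) = ip lborel \<phi> \<psi>"
proof -
  have "MLB q u \<in> borel_measurable borel" if "u \<in> sqint lborel" for u
    using MLB_in_space[OF that] by (auto simp: mlf_space_iff holomorphic_borel)
  then have "MLF_inner q (MLB q \<phi>) (MLB q \<psi>) = ip mlf (MLB q \<phi>) (MLB q \<psi>)"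
    using assms by (intro MLF_inner_eq)
  also have "\<dots> = ip lborel \<phi> \<psi>"
    using ml.Parseval[OF MLB_expands MLB_expands] herm.Parseval[OF hermite_expands hermite_expands] assms
    by (metis sums_unique2)
  finally show ?thesis .
qed

lemma MLB_eq_iff:
  assumes \<phi>: "\<phi> \<in> sqint lborel" and \<psi>: "\<psi> \<in> sqint lborel"
  shows "MLB q \<phi> = MLB q \<psi> \<longleftrightarrow> (AE x in lborel. \<phi> x = \<psi> x)"
proof
  assume eq: "MLB q \<phi> = MLB q \<psi>"
  have "hcoef \<phi> n = hcoef \<psi> n" for n
    using MLB_coef[OF \<phi>] MLB_coef[OF \<psi>] eq by (metis)
  then have "AE x in lborel. \<phi> x - \<psi> x = 0"
    by (intro hermite_complete sqint_diff \<phi> \<psi>) (simp add: ip_diff_left \<phi> \<psi>)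
  then show "AE x in lborel. \<phi> x = \<psi> x" by simp
next
  assume "AE x in lborel. \<phi> x = \<psi> x"
  then have h: "hcoef \<phi> n = hcoef \<psi> n" for n
    using \<phi> \<psi> by (intro ip_cong_AE) (auto simp: sqint_def)
  show "MLB q \<phi> = MLB q \<psi>"
  proof
    show "MLB q \<phi> z = MLB q \<psi> z" for z
      using MLB_sums[OF \<phi>, of z] MLB_sums[OF \<psi>, of z] unfolding h by (rule sums_unique2)
  qed
qed

text \<open>Linearity is read off from the coefficients through \<open>MLB_sums\<close>, in place of
  splitting the defining integral.\<close>

lemma MLB_linear:
  assumes \<phi>: "\<phi> \<in> sqint lborel" and \<psi>: "\<psi> \<in> sqint lborel"
  shows "MLB q (\<lambda>x. a * \<phi> x + b * \<psi> x) = (\<lambda>z. a * MLB q \<phi> z + b * MLB q \<psi> z)"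
proof
  fix z
  have "hcoef (\<lambda>x. a * \<phi> x + b * \<psi> x) n = a * hcoef \<phi> n + b * hcoef \<psi> n" for n
    by (simp add: ip_add_left ip_cmult_left sqint_cmult \<phi> \<psi>)
  then have "(\<lambda>n. a * (hcoef \<phi> n * mon n z) + b * (hcoef \<psi> n * mon n z)) sums
      MLB q (\<lambda>x. a * \<phi> x + b * \<psi> x) z"
    using MLB_sums[OF sqint_add[OF sqint_cmult[OF \<phi>] sqint_cmult[OF \<psi>]], of a b z]
    by (simp add: distrib_right mult.assoc)
  moreover have "(\<lambda>n. a * (hcoef \<phi> n * mon n z) + b * (hcoef \<psi> n * mon n z)) sums
      (a * MLB q \<phi> z + b * MLB q \<psi> z)"
    by (intro sums_add sums_mult MLB_sums \<phi> \<psi>)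
  ultimately show "MLB q (\<lambda>x. a * \<phi> x + b * \<psi> x) z = a * MLB q \<phi> z + b * MLB q \<psi> z"
    by (rule sums_unique2)
qed

end

theorem theorem3p8:
  fixes q :: real
  assumes "q > 0"
  shows "unitary_L2_ML q (MLB q) \<and>
         (\<forall>f\<in>MLF_space q. L2_tendsto (MLT_trunc q f) (MLT q f)) \<and>
         inverse_L2_ML q (MLB q) (MLT q) \<and>
         adjoint_L2_ML q (MLB q) (MLT q)"
proof -
  interpret mlf_order q by unfold_locales (rule assms)
  have T: "MLT q f \<in> sqint lborel" if "f \<in> MLF_space q" for f
    using MLT_expands[OF that] by (simp add: herm.expands_def)
  have "unitary_L2_ML q (MLB q)"
    unfolding unitary_L2_ML_def L2R_eq L2_eq_def L2_inner_eq
    using MLB_in_space MLB_eq_iff MLB_linear MLB_isometry MLB_MLT T by blast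
  \<comment> \<open>\<open>MLT q f\<close> has the coefficients of \<open>f\<close>, so it can
    itself serve as the limit function.\<close>
  moreover have "\<forall>f\<in>MLF_space q. L2_tendsto (MLT_trunc q f) (MLT q f)"
    using MLT_trunc_tendsto MLT_expands by blast
  moreover have "inverse_L2_ML q (MLB q) (MLT q)"
    unfolding inverse_L2_ML_def L2R_eq L2_eq_def
  proof (intro conjI ballI)
    fix \<phi> :: "real \<Rightarrow> complex" assume \<phi>: "\<phi> \<in> sqint lborel"
    \<comment> \<open>\<open>MLB\<close> sends both sides to \<open>MLB q \<phi>\<close> and is
      injective on almost everywhere classes.\<close>
    show "AE x in lborel. MLT q (MLB q \<phi>) x = \<phi> x"
      using MLB_MLT[OF MLB_in_space[OF \<phi>]] MLB_eq_iff[OF T[OF MLB_in_space[OF \<phi>]] \<phi>] by simp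
  qed (simp_all add: T MLB_MLT MLB_in_space)
  moreover have "adjoint_L2_ML q (MLB q) (MLT q)"
    unfolding adjoint_L2_ML_def L2R_eq L2_inner_eq
  proof (intro conjI ballI)
    fix \<phi> :: "real \<Rightarrow> complex" and f assume \<phi>: "\<phi> \<in> sqint lborel" and f: "f \<in> MLF_space q"
    \<comment> \<open>The isometry is applied to \<open>\<phi>\<close> and \<open>MLT q f\<close>,
      whose image under \<open>MLB\<close> is \<open>f\<close>.\<close>
    show "MLF_inner q (MLB q \<phi>) f = ip lborel \<phi> (MLT q f)"
      using MLB_isometry[OF \<phi> T[OF f]] unfolding MLB_MLT[OF f] .
  qed (rule T)
  ultimately show ?thesis by blast
qed

end
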